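(* Let $0<b_1<b_2<1$ and $q=b_1/b_2$. Let $(\eta_t)_{t\ge0}$ be a multi-class stochastic six-vertex process on the line with parameters $b_1,b_2$ and with the following initial conditions: there are some first-class particles (finitely or infinitely many); there is a single second-class particle; there are $M$ third-class particles, all to the left of the second-class particle (all other positions are holes). Let $\bm{Z}_t(0)>\bm{Z}_t(1)>\dots>\bm{Z}_t(M)$ be the ordered positions of the second- and third-class particles at time $t$, i.e. $\eta_t(x)\in\{2,3\}$ if and only if $x=\bm{Z}_t(k)$ for some $k$. Let $L_t$ be the number of third-class particles to the right of the second-class particle at time $t$. Then for any $t$, the law of $L_t$, conditioned on both $(\bm{Z}_s(k))_{0\le k\le M,\,0\le s\le t}$ and the space-time history of the first-class particles up to time $t$, is stochastically dominated by $\mathrm{Geo}(q)$, i.e. by the law of a random variable $G$ with $\mathbb{P}[G=k]=(1-q)q^k$ for $k\ge0$.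
   Context: Multi-class stochastic six-vertex process on the line: each vertex $(x,t)\in\mathbb{Z}\times\mathbb{Z}_{\ge0}$ has two incoming edges (bottom, left) and two outgoing edges (top, right). Every edge carries a class in $\mathbb{R}\cup\{-\infty,\infty\}$ (class $\infty$ is a hole). Let $(\chi^1(x,t))$ and $(\chi^2(x,t))$, $x\in\mathbb{Z},t\in\mathbb{Z}_{\ge0}$, be independent families of i.i.d. Bernoulli$(b_1)$ and Bernoulli$(b_2)$ random variables. At vertex $(x,t)$ with incoming classes $a$ from the bottom and $c$ from the left: if $a=c$, both outgoing edges have this class; if $a<c$, then $a$ exits through the top and $c$ through the right when $\chi^1(x,t)=1$, and $a$ exits through the right and $c$ through the top when $\chi^1(x,t)=0$; if $c<a$, then $c$ exits through the right and $a$ through the top when $\chi^2(x,t)=1$, and $c$ exits through the top and $a$ through the right when $\chi^2(x,t)=0$. Given the classes $\eta_0(x)$ of the edges entering $(x,0)$ from below, there is almost surely a unique assignment of classes to all edges consistent with these rules (in each row there are almost surely vertices with $\chi^1=\chi^2=0$ arbitrarily far to the left, and there the bottom class always exits right and the left class always exits through the top). For $t\ge0$, $\eta_t(x)$ is the class of the edge entering $(x,t)$ from below. A $k$-th class particle is at position $x$ at time $t$ if $\eta_t(x)=k$. The initial configuration $\eta_0$ is deterministic. The space-time history of the first-class particles up to time $t$ is the collection of all edges (vertical and horizontal) occupied by class $1$ up to time $t$. *)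

theory Defs
  imports "HOL-Probability.Probability"
begin

text \<open>
  Classes are extended reals and \<^term>\<open>\<infinity> :: ereal\<close> is a hole. A vertex with class \<open>a\<close> entering
  from the bottom and class \<open>c\<close> entering from the left is mapped to the pair (class leaving
  through the top, class leaving through the right).
\<close>

definition vertex_out :: "bool \<Rightarrow> bool \<Rightarrow> ereal \<Rightarrow> ereal \<Rightarrow> ereal \<times> ereal" where
  "vertex_out chi1 chi2 a c =
     (if a = c then (a, c)
      else if a < c then (if chi1 then (a, c) else (c, a))
      else (if chi2 then (a, c) else (c, a)))"

text \<open>
  \<open>v x t\<close> is the class of the vertical edge entering \<open>(x, t)\<close> from below (written $\eta_t(x)$ in
  the literature), and \<open>h x t\<close> the class of the horizontal edge entering \<open>(x, t)\<close> from the left.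
  Hence \<open>v x (Suc t)\<close> and \<open>h (x + 1) t\<close> are the classes leaving \<open>(x, t)\<close>.
\<close>

definition consistent_classes ::
  "(int \<Rightarrow> nat \<Rightarrow> bool) \<Rightarrow> (int \<Rightarrow> nat \<Rightarrow> bool) \<Rightarrow> (int \<Rightarrow> ereal) \<Rightarrow>
   (int \<Rightarrow> nat \<Rightarrow> ereal) \<Rightarrow> (int \<Rightarrow> nat \<Rightarrow> ereal) \<Rightarrow> bool" where
  "consistent_classes chi1 chi2 eta0 v h \<longleftrightarrow>
     (\<forall>x. v x 0 = eta0 x) \<and>
     (\<forall>x t. (v x (Suc t), h (x + 1) t) = vertex_out (chi1 x t) (chi2 x t) (v x t) (h x t))"

text \<open>
  Almost surely exactly one assignment of classes is consistent with the variables at the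
  vertices, so the last assumption determines \<open>V\<close> and \<open>H\<close> up to a null set.
\<close>

locale stochastic_six_vertex = prob_space P for P :: "'w measure" +
  fixes b1 b2 :: real
    and eta0 :: "int \<Rightarrow> ereal"
    and chi1 chi2 :: "int \<Rightarrow> nat \<Rightarrow> 'w \<Rightarrow> bool"
    and V H :: "int \<Rightarrow> nat \<Rightarrow> 'w \<Rightarrow> ereal"
  assumes indep_chi:
      "indep_vars (\<lambda>_. count_space UNIV)
         (case_sum (\<lambda>(x, t). chi1 x t) (\<lambda>(x, t). chi2 x t)) UNIV"
    and distr_chi1: "\<And>x t. distr P (count_space UNIV) (chi1 x t) = measure_pmf (bernoulli_pmf b1)"
    and distr_chi2: "\<And>x t. distr P (count_space UNIV) (chi2 x t) = measure_pmf (bernoulli_pmf b2)"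
    and measurable_V: "\<And>x t. V x t \<in> borel_measurable P"
    and measurable_H: "\<And>x t. H x t \<in> borel_measurable P"
    and consistent:
      "AE w in P. consistent_classes (\<lambda>x t. chi1 x t w) (\<lambda>x t. chi2 x t w) eta0
                    (\<lambda>x t. V x t w) (\<lambda>x t. H x t w)"

text \<open>
  The next two functions take a configuration \<open>eta\<close> at a fixed time. Positions are listed in
  decreasing order, counting from \<open>0\<close>. The values are meaningful if \<open>eta\<close> has finitely many
  second- and third-class particles and, for the first function, more than \<open>k\<close> of them.
\<close>

definition ordered_position :: "(int \<Rightarrow> ereal) \<Rightarrow> nat \<Rightarrow> int" where
  "ordered_position eta k = rev (sorted_list_of_set {x. eta x \<in> {2, 3}}) ! k"

definition thirds_right_of_second :: "(int \<Rightarrow> ereal) \<Rightarrow> nat" where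
  "thirds_right_of_second eta = card {x. eta x = 3 \<and> (\<exists>y. eta y = 2 \<and> y < x)}"

text \<open>
  The sigma-algebra generated by the positions \<open>Z s k\<close> with \<open>s \<le> t\<close>, \<open>k \<le> M\<close>, and by the set
  of edges of class \<open>1\<close> up to time \<open>t\<close>. The configuration at time \<open>t\<close> is produced by the vertices
  in rows \<open>0, \<dots>, t - 1\<close>, so the horizontal edges up to time \<open>t\<close> are those in these rows.
\<close>

definition history ::
  "'w measure \<Rightarrow> (int \<Rightarrow> nat \<Rightarrow> 'w \<Rightarrow> ereal) \<Rightarrow> (int \<Rightarrow> nat \<Rightarrow> 'w \<Rightarrow> ereal) \<Rightarrow>
   (nat \<Rightarrow> nat \<Rightarrow> 'w \<Rightarrow> int) \<Rightarrow> nat \<Rightarrow> nat \<Rightarrow> 'w measure" where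
  "history P V H Z M t = sigma (space P)
     ({{w \<in> space P. Z s k w = z} | s k z. s \<le> t \<and> k \<le> M} \<union>
      {{w \<in> space P. V x s w = 1} | x s. s \<le> t} \<union>
      {{w \<in> space P. H x s w = 1} | x s. s < t})"

definition cond_prob_of :: "'w measure \<Rightarrow> 'w measure \<Rightarrow> ('w \<Rightarrow> bool) \<Rightarrow> 'w \<Rightarrow> real" where
  "cond_prob_of P F A = real_cond_exp P F (indicator {w \<in> space P. A w})"

definition cond_law_dominated_by ::
  "'w measure \<Rightarrow> 'w measure \<Rightarrow> ('w \<Rightarrow> nat) \<Rightarrow> nat pmf \<Rightarrow> bool" where
  "cond_law_dominated_by P F X D \<longleftrightarrow>
     (AE w in P. \<forall>k. cond_prob_of P F (\<lambda>w'. k \<le> X w') w \<le> measure_pmf.prob D {k..})"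

end

theory Submission
  imports Defs "HOL-Combinatorics.Transposition"
begin

text \<open>
  Identify the classes 2 and 3. Since a vertex with two incoming particles of classes in
  \<open>{2, 3}\<close> has two outgoing ones whatever its variables are, the merged process ignores these
  variables, and given the merged process the rank of the second-class particle among the merged
  particles performs a nearest-neighbour walk: whenever the particles of ranks \<open>r\<close> and \<open>r + 1\<close> meet, it
  moves from \<open>r\<close> to \<open>r + 1\<close> with probability \<open>b1\<close> and back with probability \<open>b2\<close>. The walk starts at
  \<open>0\<close>, and each such step preserves the bounds \<open>P(rank \<ge> k + 1) \<le> q P(rank \<ge> k)\<close>.

  To reduce to finitely many vertices, set all variables outside a box to \<open>0\<close>. Almost surely there
  are diagonals \<open>(c, 0), (c + 1, 1), \<dots>\<close> of vertices with both variables \<open>0\<close> arbitrarily far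
  to the left and to the right. What happens to the right of such a diagonal does not depend on
  what happens to its left, so the box process eventually agrees with the original one, and events
  of the history are approximated in probability by events of the merged box process.
\<close>

section \<open>Zero diagonals and the process in a box\<close>

lemma vertex_out_False [simp]: "vertex_out False False a c = (c, a)"
  by (simp add: vertex_out_def)

lemma vertex_out_cases: "vertex_out b1 b2 a c = (a, c) \<or> vertex_out b1 b2 a c = (c, a)"
  by (simp add: vertex_out_def)

text \<open>A vertex with both variables zero sends its bottom class to the right and its left class
  to the top. The top edge of a diagonal vertex lies to the left of the next diagonal vertex, so no
  class crosses the diagonal from left to right.\<close>

definition zero_diagonal ::
  "nat \<Rightarrow> (int \<Rightarrow> nat \<Rightarrow> bool) \<Rightarrow> (int \<Rightarrow> nat \<Rightarrow> bool) \<Rightarrow> int \<Rightarrow> bool" where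
  "zero_diagonal t c1 c2 c \<longleftrightarrow> (\<forall>s<t. \<not> c1 (c + int s) s \<and> \<not> c2 (c + int s) s)"

lemma consistent_classes_step:
  assumes "consistent_classes c1 c2 eta v h"
  shows "v x (Suc s) = fst (vertex_out (c1 x s) (c2 x s) (v x s) (h x s))"
    and "h (x + 1) s = snd (vertex_out (c1 x s) (c2 x s) (v x s) (h x s))"
  using assms unfolding consistent_classes_def by (metis fst_conv, metis snd_conv)

text \<open>Nothing enters from the left of the diagonal and classes never move left, so up to
  column \<open>b\<close> the edges are determined by \<open>eta\<close> and the variables in this
  region. The induction along a row starts at the diagonal vertex, whose right output is its bottom
  input.\<close>

lemma right_of_zero_diagonal_unique:
  assumes cc: "consistent_classes c1 c2 eta v h" "consistent_classes d1 d2 eta v' h'"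
    and zd: "zero_diagonal t c1 c2 c" "zero_diagonal t d1 d2 c"
    and eq: "\<And>x s. s < t \<Longrightarrow> c + int s \<le> x \<Longrightarrow> x \<le> b \<Longrightarrow> c1 x s = d1 x s \<and> c2 x s = d2 x s"
  shows "s \<le> t \<Longrightarrow> c + int s \<le> x \<Longrightarrow> x \<le> b \<Longrightarrow> v x s = v' x s"
    and "s < t \<Longrightarrow> c + int s < x \<Longrightarrow> x \<le> b + 1 \<Longrightarrow> h x s = h' x s"
proof -
  have horiz: "h x s = h' x s"
    if IH: "\<And>x. c + int s \<le> x \<Longrightarrow> x \<le> b \<Longrightarrow> v x s = v' x s" and s: "s < t"
      and x: "c + int s + 1 \<le> x" "x \<le> b + 1" for s x
    using x
  proof (induction x rule: int_ge_induct)
    case base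
    have "h (c + int s + 1) s = v (c + int s) s" "h' (c + int s + 1) s = v' (c + int s) s"
      using consistent_classes_step(2)[OF cc(1), of "c + int s" s]
        consistent_classes_step(2)[OF cc(2), of "c + int s" s] zd s
      by (auto simp: zero_diagonal_def)
    then show ?case using IH[of "c + int s"] base by simp
  next
    case (step x)
    then show ?case
      using consistent_classes_step(2)[OF cc(1), of x s] consistent_classes_step(2)[OF cc(2), of x s]
        IH[of x] eq[of s x] s by simp
  qed
  have vert: "\<forall>x. c + int s \<le> x \<longrightarrow> x \<le> b \<longrightarrow> v x s = v' x s" if "s \<le> t" for s
    using that
  proof (induction s)
    case 0
    then show ?case using cc by (simp add: consistent_classes_def)
  next
    case (Suc s)
    show ?case
    proof (intro allI impI)
      fix x assume x: "c + int (Suc s) \<le> x" "x \<le> b"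
      have "v x s = v' x s" "h x s = h' x s"
        using Suc x horiz[of s x] by auto
      then show "v x (Suc s) = v' x (Suc s)"
        using consistent_classes_step(1)[OF cc(1), of x s] consistent_classes_step(1)[OF cc(2), of x s]
          eq[of s x] Suc x by simp
    qed
  qed
  show "s \<le> t \<Longrightarrow> c + int s \<le> x \<Longrightarrow> x \<le> b \<Longrightarrow> v x s = v' x s"
    using vert by blast
  show "s < t \<Longrightarrow> c + int s < x \<Longrightarrow> x \<le> b + 1 \<Longrightarrow> h x s = h' x s"
    using horiz[of s x] vert[of s] by auto
qed

text \<open>Vertices only permute their incoming classes, the diagonal shuts out classes from its
  left, and no class comes back from column \<open>b\<close> or beyond.\<close>

lemma right_of_zero_diagonal_avoids:
  assumes cc: "consistent_classes c1 c2 eta v h" and zd: "zero_diagonal t c1 c2 c"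
    and eta: "\<And>x. c \<le> x \<Longrightarrow> x < b \<Longrightarrow> eta x \<notin> C"
  shows "s \<le> t \<Longrightarrow> c + int s \<le> x \<Longrightarrow> x < b \<Longrightarrow> v x s \<notin> C"
proof (induction s arbitrary: x)
  case 0
  then show ?case using cc eta by (simp add: consistent_classes_def)
next
  case (Suc s)
  have "h y s \<notin> C" if y: "c + int s + 1 \<le> y" "y \<le> b" for y
    using y
  proof (induction y rule: int_ge_induct)
    case base
    have "h (c + int s + 1) s = v (c + int s) s"
      using consistent_classes_step(2)[OF cc(1), of "c + int s" s] zd Suc.prems
      by (auto simp: zero_diagonal_def)
    then show ?case using Suc.IH[of "c + int s"] Suc.prems base by simp
  next
    case (step y)
    then show ?case
      using consistent_classes_step(2)[OF cc(1), of y s] Suc.IH[of y] Suc.prems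
        vertex_out_cases[of "c1 y s" "c2 y s" "v y s" "h y s"] by auto
  qed
  then show ?case
    using consistent_classes_step(1)[OF cc(1), of x s] Suc.IH[of x] Suc.prems
      vertex_out_cases[of "c1 x s" "c2 x s" "v x s" "h x s"] by auto
qed

text \<open>
  The classes along a down-right lattice path are stored as a function on the integers: the vertical
  edge entering \<open>(x, s)\<close> from below sits at index \<open>x - s\<close>, the horizontal edge entering it from the
  left at index \<open>x - s - 1\<close>. Passing the path through \<open>(x, s)\<close> then changes only these two entries.
\<close>

definition cross :: "bool \<Rightarrow> bool \<Rightarrow> int \<Rightarrow> (int \<Rightarrow> ereal) \<Rightarrow> int \<Rightarrow> ereal" where
  "cross e1 e2 p \<sigma> =
     (let (a, c) = vertex_out e1 e2 (\<sigma> (p + 1)) (\<sigma> p) in \<sigma>(p := a, p + 1 := c))"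

section \<open>The process in a box, run vertex by vertex\<close>

primrec front ::
  "(nat \<Rightarrow> int \<times> nat) \<Rightarrow> (int \<Rightarrow> ereal) \<Rightarrow> (int \<Rightarrow> nat \<Rightarrow> bool) \<Rightarrow> (int \<Rightarrow> nat \<Rightarrow> bool) \<Rightarrow> nat \<Rightarrow> int \<Rightarrow> ereal"
  where
    "front u eta c1 c2 0 = eta"
  | "front u eta c1 c2 (Suc n) =
       (let (x, s) = u n in cross (c1 x s) (c2 x s) (x - int s - 1) (front u eta c1 c2 n))"

text \<open>Rows are passed from bottom to top, each from column \<open>- N\<close> to
  \<open>N\<close>, so the path can be pushed through the vertices one at a time. The first
  \<open>t\<close> rows are the first \<open>t * (2 * N + 1)\<close> steps.\<close>

definition box_site :: "nat \<Rightarrow> nat \<Rightarrow> int \<times> nat" where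
  "box_site N n = (int (n mod (2 * N + 1)) - int N, n div (2 * N + 1))"

lemma inj_box_site: "inj (box_site N)"
proof (rule injI)
  fix m n assume "box_site N m = box_site N n"
  then have "m mod (2 * N + 1) = n mod (2 * N + 1)" "m div (2 * N + 1) = n div (2 * N + 1)"
    by (auto simp: box_site_def)
  then show "m = n" by (metis div_mult_mod_eq)
qed

abbreviation box_front where "box_front N \<equiv> front (box_site N)"

text \<open>The number of vertices of a row of the box strictly left of column \<open>x\<close>.
  After that many steps within the row the horizontal edge entering column \<open>x\<close> lies on
  the path.\<close>

definition box_column :: "nat \<Rightarrow> int \<Rightarrow> nat" where
  "box_column N x = nat (min (max (x + int N) 0) (2 * int N + 1))"

definition box_chi :: "nat \<Rightarrow> (int \<Rightarrow> nat \<Rightarrow> bool) \<Rightarrow> int \<Rightarrow> nat \<Rightarrow> bool" where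
  "box_chi N c x s \<longleftrightarrow> c x s \<and> - int N \<le> x \<and> x \<le> int N"

definition box_v where
  "box_v N eta c1 c2 x s = box_front N eta c1 c2 (s * (2 * N + 1)) (x - int s)"

definition box_h where
  "box_h N eta c1 c2 x s =
     box_front N eta c1 c2 (s * (2 * N + 1) + box_column N x) (x - int s - 1)"

lemma box_front_row_Suc:
  assumes "j < 2 * N + 1"
  shows "box_front N eta c1 c2 (Suc (s * (2 * N + 1) + j)) =
    cross (c1 (int j - int N) s) (c2 (int j - int N) s) (int j - int N - int s - 1)
      (box_front N eta c1 c2 (s * (2 * N + 1) + j))"
proof -
  have "(s * (2 * N + 1) + j) div (2 * N + 1) = s" "(s * (2 * N + 1) + j) mod (2 * N + 1) = j"
    using assms by (auto simp del: mult_Suc_right add_Suc_right)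
  then have "box_site N (s * (2 * N + 1) + j) = (int j - int N, s)"
    unfolding box_site_def by simp
  then show ?thesis unfolding front.simps by simp
qed

lemma cross_other [simp]: "y \<noteq> p \<Longrightarrow> y \<noteq> p + 1 \<Longrightarrow> cross e1 e2 p \<sigma> y = \<sigma> y"
  by (simp add: cross_def split: prod.splits)

lemma cross_at: "(cross e1 e2 p \<sigma> p, cross e1 e2 p \<sigma> (p + 1)) = vertex_out e1 e2 (\<sigma> (p + 1)) (\<sigma> p)"
  by (simp add: cross_def split: prod.splits)

text \<open>The first \<open>j\<close> vertices of row \<open>s\<close> touch only indices up to
  \<open>j - 1 - N - s\<close>.\<close>

lemma box_front_before_site:
  assumes "j \<le> 2 * N + 1" and "int j \<le> y + int s + int N"
  shows "box_front N eta c1 c2 (s * (2 * N + 1) + j) y = box_front N eta c1 c2 (s * (2 * N + 1)) y"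
  using assms
proof (induction j)
  case (Suc j)
  then show ?case using box_front_row_Suc[of j N eta c1 c2 s] by simp
qed simp

text \<open>Counting from 0, the vertices of row \<open>s\<close> from number \<open>j\<close> on
  touch only indices from \<open>j - N - s - 1\<close> on.\<close>

lemma box_front_after_site:
  assumes "j \<le> 2 * N + 1" and "y + int s + int N + 1 < int j" and "j \<le> j'" and "j' \<le> 2 * N + 1"
  shows "box_front N eta c1 c2 (s * (2 * N + 1) + j') y = box_front N eta c1 c2 (s * (2 * N + 1) + j) y"
  using assms(3,4)
proof (induction j' rule: dec_induct)
  case (step j')
  then show ?case using box_front_row_Suc[of j' N eta c1 c2 s] assms by simp
qed simp

text \<open>Outside the box both variables are zero, and crossing such a vertex leaves the stored
  path unchanged: the top output takes over the index and the class of the left input, the right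
  output those of the bottom input. Skipping these vertices therefore still gives a process on the
  whole line.\<close>

lemma box_consistent:
  "consistent_classes (box_chi N c1) (box_chi N c2) eta (box_v N eta c1 c2) (box_h N eta c1 c2)"
  unfolding consistent_classes_def
proof (intro conjI allI)
  fix x show "box_v N eta c1 c2 x 0 = eta x" by (simp add: box_v_def)
next
  fix x s
  let ?W = "2 * N + 1"
  let ?f = "box_front N eta c1 c2"
  let ?j = "box_column N x" and ?j' = "box_column N (x + 1)"
  have v: "box_v N eta c1 c2 x s = ?f (s * ?W + ?j) (x - int s)"
    unfolding box_v_def
  proof (cases "x < - int N")
    case False
    then show "?f (s * ?W) (x - int s) = ?f (s * ?W + ?j) (x - int s)"
      by (intro box_front_before_site[symmetric]) (auto simp: box_column_def)
  qed (simp add: box_column_def)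
  \<comment> \<open>The top edge of \<open>(x, s)\<close> has index \<open>x - s - 1\<close>. Later
    vertices of the row touch larger indices only, so its value survives to the end of the
    row.\<close>
  have v': "box_v N eta c1 c2 x (Suc s) = ?f (s * ?W + ?j') (x - int s - 1)"
  proof -
    have "?f (s * ?W + ?W) (x - int s - 1) = ?f (s * ?W + ?j') (x - int s - 1)"
    proof (cases "x \<le> int N")
      case True
      show ?thesis
      proof (cases "x + 1 \<le> - int N")
        case False
        then show ?thesis using True
        by (intro box_front_after_site) (auto simp: box_column_def)
      next
        case True
        then have j': "?j' = 0" by (simp add: box_column_def)
        show ?thesis unfolding j' using True
          by (intro box_front_after_site) (auto simp: box_column_def)
      qed
    next
      case False
      then have "?j' = ?W" by (auto simp: box_column_def)
      then show ?thesis by (simp only:)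
    qed
    then show ?thesis by (simp add: box_v_def algebra_simps)
  qed
  show "(box_v N eta c1 c2 x (Suc s), box_h N eta c1 c2 (x + 1) s) =
    vertex_out (box_chi N c1 x s) (box_chi N c2 x s) (box_v N eta c1 c2 x s) (box_h N eta c1 c2 x s)"
  proof (cases "- int N \<le> x \<and> x \<le> int N")
    case True
    then have j: "?j < ?W" "?j' = Suc ?j" "int ?j - int N = x"
      by (auto simp: box_column_def)
    have "?f (s * ?W + ?j') = cross (c1 x s) (c2 x s) (x - int s - 1) (?f (s * ?W + ?j))"
      using box_front_row_Suc[OF j(1), of eta c1 c2 s] j(2,3) by simp
    then show ?thesis
      using True cross_at[of "c1 x s" "c2 x s" "x - int s - 1" "?f (s * ?W + ?j)"]
      unfolding v v' by (simp add: box_h_def box_chi_def)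
  next
    case False
    then have "?j' = ?j" by (auto simp: box_column_def)
    moreover have "\<not> box_chi N c1 x s" "\<not> box_chi N c2 x s" using False by (auto simp: box_chi_def)
    ultimately show ?thesis unfolding v v' by (simp add: box_h_def)
  qed
qed

section \<open>The merged process\<close>

lemma class_order [simp]:
  "(1::ereal) < 2" "(1::ereal) < 3" "(2::ereal) < 3" "(2::ereal) < \<infinity>" "(3::ereal) < \<infinity>"
  "\<not> (3::ereal) < 2" "\<not> (2::ereal) < 1" "\<not> (3::ereal) < 1"
  "(1::ereal) \<noteq> 2" "(1::ereal) \<noteq> 3" "(2::ereal) \<noteq> 3" "(2::ereal) \<noteq> \<infinity>" "(3::ereal) \<noteq> \<infinity>"
  "(2::ereal) \<noteq> 1" "(3::ereal) \<noteq> 1" "(3::ereal) \<noteq> 2" "\<infinity> \<noteq> (2::ereal)" "\<infinity> \<noteq> (3::ereal)"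
  by simp_all

text \<open>
  Otherwise the simplifier replaces the class \<open>2\<close> by \<open>ereal 2\<close>.
\<close>

declare numeral_eq_ereal [simp del]


definition merge_class :: "ereal \<Rightarrow> ereal" where
  "merge_class c = (if c \<in> {2, 3} then 2 else c)"

lemma merge_class_eq_2_iff [simp]: "merge_class c = 2 \<longleftrightarrow> c \<in> {2, 3}"
  by (simp add: merge_class_def)

text \<open>Merging preserves the order of any two of the four classes except within the pair 2, 3,
  so apart from such pairs the merged vertex makes the same choice.\<close>

lemma vertex_out_merge:
  assumes "a \<in> {1, 2, 3, \<infinity>}" "c \<in> {1, 2, 3, \<infinity>}" "\<not> (a \<in> {2, 3} \<and> c \<in> {2, 3})"
  shows "vertex_out e1 e2 (merge_class a) (merge_class c) = map_prod merge_class merge_class (vertex_out e1 e2 a c)"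
proof -
  have "merge_class a = merge_class c \<longleftrightarrow> a = c" "merge_class a < merge_class c \<longleftrightarrow> a < c"
    using assms by (auto simp: merge_class_def)
  then show ?thesis by (simp add: vertex_out_def)
qed

section \<open>Configurations along a path and the effect of a crossing\<close>

definition admissible :: "(int \<Rightarrow> ereal) \<Rightarrow> bool" where
  "admissible \<sigma> \<longleftrightarrow> (\<forall>x. \<sigma> x \<in> {1, 2, 3, \<infinity>}) \<and> (\<exists>!x. \<sigma> x = 2) \<and> finite {x. \<sigma> x = 3}"

text \<open>On the stored path a crossing is the identity or a transposition of neighbours, so
  invariants need to be checked for transpositions only.\<close>

lemma cross_cases:
  "cross e1 e2 p \<sigma> = \<sigma> \<or> cross e1 e2 p \<sigma> = \<sigma> \<circ> Transposition.transpose p (p + 1)"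
  using vertex_out_cases[of e1 e2 "\<sigma> (p + 1)" "\<sigma> p"]
  by (auto simp: cross_def fun_eq_iff Transposition.transpose_def)

lemma admissible_transpose:
  assumes "admissible \<sigma>"
  shows "admissible (\<sigma> \<circ> Transposition.transpose p r)"
proof -
  have "{x. (\<sigma> \<circ> Transposition.transpose p r) x = 3} = Transposition.transpose p r ` {x. \<sigma> x = 3}"
    by (simp add: bij_image_Collect_eq)
  then have "finite {x. (\<sigma> \<circ> Transposition.transpose p r) x = 3}"
    using assms by (simp only: admissible_def finite_imageI)
  moreover have "\<exists>!x. (\<sigma> \<circ> Transposition.transpose p r) x = 2"
  proof -
    obtain y where "\<And>x. \<sigma> x = 2 \<longleftrightarrow> x = y" using assms unfolding admissible_def by metis
    then show ?thesis by (intro ex1I[of _ "Transposition.transpose p r y"]) (auto simp: transpose_eq_iff)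
  qed
  moreover have "\<forall>x. (\<sigma> \<circ> Transposition.transpose p r) x \<in> {1, 2, 3, \<infinity>}"
    using assms by (simp add: admissible_def)
  ultimately show ?thesis
    unfolding admissible_def by (intro conjI)
qed

lemma admissible_cross: "admissible \<sigma> \<Longrightarrow> admissible (cross e1 e2 p \<sigma>)"
  using cross_cases[of e1 e2 p \<sigma>] admissible_transpose by metis

lemma admissible_front: "admissible eta \<Longrightarrow> admissible (front u eta c1 c2 n)"
  by (induction n) (auto simp: admissible_cross split: prod.splits)

text \<open>Two entries of equal merged class are permuted, so the merged process reveals nothing
  about the variables of such a vertex.\<close>

lemma merge_cross_pair:
  assumes "merge_class (\<sigma> p) = 2" "merge_class (\<sigma> (p + 1)) = 2"
  shows "merge_class \<circ> cross e1 e2 p \<sigma> = merge_class \<circ> \<sigma>"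
proof
  fix x
  have "merge_class (cross e1 e2 p \<sigma> p) = 2" "merge_class (cross e1 e2 p \<sigma> (p + 1)) = 2"
    using cross_cases[of e1 e2 p \<sigma>] assms by auto
  then show "(merge_class \<circ> cross e1 e2 p \<sigma>) x = (merge_class \<circ> \<sigma>) x"
    using assms by (cases "x = p \<or> x = p + 1") (auto simp del: merge_class_eq_2_iff)
qed

lemma merge_cross_nonpair:
  assumes "admissible \<sigma>" "\<not> (merge_class (\<sigma> p) = 2 \<and> merge_class (\<sigma> (p + 1)) = 2)"
  shows "merge_class \<circ> cross e1 e2 p \<sigma> = cross e1 e2 p (merge_class \<circ> \<sigma>)"
proof -
  have "vertex_out e1 e2 (merge_class (\<sigma> (p + 1))) (merge_class (\<sigma> p)) =
      map_prod merge_class merge_class (vertex_out e1 e2 (\<sigma> (p + 1)) (\<sigma> p))"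
    using assms by (intro vertex_out_merge) (auto simp: admissible_def)
  then show ?thesis
    by (auto simp: cross_def fun_eq_iff split: prod.splits)
qed

text \<open>A transposition of neighbours reverses the order of the pair \<open>p\<close>,
  \<open>p + 1\<close> only, and this pair does not consist of two particles of classes 2 and
  3.\<close>

lemma thirds_right_cross_nonpair:
  assumes "\<not> (merge_class (\<sigma> p) = 2 \<and> merge_class (\<sigma> (p + 1)) = 2)"
  shows "thirds_right_of_second (cross e1 e2 p \<sigma>) = thirds_right_of_second \<sigma>"
proof -
  let ?t = "Transposition.transpose p (p + 1)"
  have mono: "?t y < ?t x" if "y < x" "\<not> (y = p \<and> x = p + 1)" for x y :: int
    using that by (auto simp: Transposition.transpose_def)
  have "{x. (\<sigma> \<circ> ?t) x = 3 \<and> (\<exists>y. (\<sigma> \<circ> ?t) y = 2 \<and> y < x)} =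
      ?t ` {x. \<sigma> x = 3 \<and> (\<exists>y. \<sigma> y = 2 \<and> y < x)}"
  proof (intro equalityI subsetI)
    fix x assume "x \<in> {x. (\<sigma> \<circ> ?t) x = 3 \<and> (\<exists>y. (\<sigma> \<circ> ?t) y = 2 \<and> y < x)}"
    then obtain y where y: "\<sigma> (?t x) = 3" "\<sigma> (?t y) = 2" "y < x" by auto
    have "\<not> (y = p \<and> x = p + 1)" using assms y by auto
    then have "?t y < ?t x" using mono y by blast
    then have "?t x \<in> {x. \<sigma> x = 3 \<and> (\<exists>y. \<sigma> y = 2 \<and> y < x)}" using y by auto
    then show "x \<in> ?t ` {x. \<sigma> x = 3 \<and> (\<exists>y. \<sigma> y = 2 \<and> y < x)}"
      by (intro image_eqI[of _ _ "?t x"]) simp_all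
  next
    fix z assume "z \<in> ?t ` {x. \<sigma> x = 3 \<and> (\<exists>y. \<sigma> y = 2 \<and> y < x)}"
    then obtain x y where y: "z = ?t x" "\<sigma> x = 3" "\<sigma> y = 2" "y < x" by auto
    have "\<not> (y = p \<and> x = p + 1)" using assms y by auto
    then have "?t y < ?t x" using mono y by blast
    then show "z \<in> {x. (\<sigma> \<circ> ?t) x = 3 \<and> (\<exists>y. (\<sigma> \<circ> ?t) y = 2 \<and> y < x)}"
      using y by (auto intro!: exI[of _ "?t y"])
  qed
  then have "thirds_right_of_second (\<sigma> \<circ> ?t) = thirds_right_of_second \<sigma>"
    unfolding thirds_right_of_second_def by (simp add: card_image)
  then show ?thesis using cross_cases[of e1 e2 p \<sigma>] by metis
qed

text \<open>This identifies \<open>thirds_right_of_second\<close> with the rank of the second-class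
  particle among the merged particles, counted from the right starting at 0.\<close>

lemma thirds_right_eq_card_merged:
  assumes "admissible \<sigma>" "\<sigma> y = 2"
  shows "thirds_right_of_second \<sigma> = card {x. y < x \<and> merge_class (\<sigma> x) = 2}"
proof -
  have "\<sigma> z = 2 \<longleftrightarrow> z = y" for z using assms by (auto simp: admissible_def)
  then have "{x. \<sigma> x = 3 \<and> (\<exists>y. \<sigma> y = 2 \<and> y < x)} = {x. y < x \<and> merge_class (\<sigma> x) = 2}"
    by auto
  then show ?thesis by (simp add: thirds_right_of_second_def)
qed

lemma finite_merged: "admissible \<sigma> \<Longrightarrow> finite {x. merge_class (\<sigma> x) = 2}"
proof -
  assume adm: "admissible \<sigma>"
  then obtain y where "\<sigma> y = 2" by (auto simp: admissible_def)
  then have "{x. merge_class (\<sigma> x) = 2} \<subseteq> insert y {x. \<sigma> x = 3}"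
    using adm by (auto simp: admissible_def)
  then show ?thesis using adm by (auto simp: admissible_def intro: finite_subset)
qed

text \<open>The merged particles at \<open>p + 1\<close> and \<open>p\<close> have ranks
  \<open>r\<close> and \<open>Suc r\<close>. A particle further right has a rank below
  \<open>r\<close>, one further left a rank above \<open>Suc r\<close>.\<close>

lemma thirds_right_pair_iff:
  assumes adm: "admissible \<sigma>" and pair: "merge_class (\<sigma> p) = 2" "merge_class (\<sigma> (p + 1)) = 2"
    and r: "r = card {x. p + 1 < x \<and> merge_class (\<sigma> x) = 2}"
  shows "thirds_right_of_second \<sigma> = r \<longleftrightarrow> \<sigma> (p + 1) = 2"
    and "thirds_right_of_second \<sigma> = Suc r \<longleftrightarrow> \<sigma> p = 2"
proof -
  obtain y where y: "\<sigma> y = 2" and uniq: "\<And>z. \<sigma> z = 2 \<longleftrightarrow> z = y"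
    using adm unfolding admissible_def by metis
  note K = thirds_right_eq_card_merged[OF adm y]
  let ?T = "\<lambda>z. {x. z < x \<and> merge_class (\<sigma> x) = 2}"
  have fin: "finite (?T z)" for z
    using finite_merged[OF adm] by (rule rev_finite_subset) auto
  have "?T p = insert (p + 1) (?T (p + 1))" using pair by auto
  then have Suc_r: "card (?T p) = Suc r" using r fin by simp
  consider "y = p + 1" | "y = p" | "y > p + 1" | "y < p" by linarith
  then have "(thirds_right_of_second \<sigma> = r \<longleftrightarrow> y = p + 1) \<and>
    (thirds_right_of_second \<sigma> = Suc r \<longleftrightarrow> y = p)"
  proof cases
    case 3
    have "?T y \<subset> ?T (p + 1)" using 3 y by auto
    then have "card (?T y) < r" using r fin psubset_card_mono by metis
    then show ?thesis using K 3 by simp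
  next
    case 4
    have "?T p \<subset> ?T y" using 4 pair by auto
    then have "Suc r < card (?T y)" using Suc_r fin psubset_card_mono by metis
    then show ?thesis using K 4 by simp
  qed (use K r Suc_r in auto)
  then show "thirds_right_of_second \<sigma> = r \<longleftrightarrow> \<sigma> (p + 1) = 2"
    and "thirds_right_of_second \<sigma> = Suc r \<longleftrightarrow> \<sigma> p = 2" unfolding uniq by auto
qed

text \<open>One step of the walk. The entry at \<open>p + 1\<close> comes from the bottom and the
  entry at \<open>p\<close> from the left, so \<open>e1\<close> decides if the second-class particle
  has rank \<open>r\<close>, and \<open>e2\<close> if it has rank \<open>Suc r\<close>. Leaving
  through the top puts it at \<open>p\<close>, leaving to the right at \<open>p + 1\<close>.\<close>

lemma thirds_right_cross_pair:
  assumes adm: "admissible \<sigma>" and pair: "merge_class (\<sigma> p) = 2" "merge_class (\<sigma> (p + 1)) = 2"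
    and r: "r = card {x. p + 1 < x \<and> merge_class (\<sigma> x) = 2}"
  shows "thirds_right_of_second (cross e1 e2 p \<sigma>) =
    (if thirds_right_of_second \<sigma> = r \<and> e1 then Suc r
     else if thirds_right_of_second \<sigma> = Suc r \<and> e2 then r
     else thirds_right_of_second \<sigma>)"
proof -
  let ?\<sigma>' = "cross e1 e2 p \<sigma>"
  have m: "merge_class (?\<sigma>' x) = merge_class (\<sigma> x)" for x
    using merge_cross_pair[OF pair] by (metis comp_apply)
  \<comment> \<open>The crossing keeps all merged classes, so the same \<open>r\<close> serves
    before and after it.\<close>
  note iff = thirds_right_pair_iff[OF adm pair r]
    thirds_right_pair_iff[OF admissible_cross[OF adm, of e1 e2 p], of p r]
  note iff' = iff(1,2) iff(3,4)[unfolded m, OF pair r]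
  have at: "(?\<sigma>' p, ?\<sigma>' (p + 1)) = vertex_out e1 e2 (\<sigma> (p + 1)) (\<sigma> p)" by (rule cross_at)
  have le: "\<not> (\<sigma> p = 2 \<and> \<sigma> (p + 1) = 2)"
  proof
    assume "\<sigma> p = 2 \<and> \<sigma> (p + 1) = 2"
    then have "p = p + 1" using adm unfolding admissible_def by blast
    then show False by simp
  qed
  have vals: "\<sigma> p \<in> {2, 3}" "\<sigma> (p + 1) \<in> {2, 3}" using pair by auto
  consider "\<sigma> (p + 1) = 2" "\<sigma> p = 3" | "\<sigma> p = 2" "\<sigma> (p + 1) = 3" | "\<sigma> p = 3" "\<sigma> (p + 1) = 3"
    using vals le by auto
  then show ?thesis
  proof cases
    case 1
    then have "?\<sigma>' p = 2 \<longleftrightarrow> e1" "?\<sigma>' (p + 1) = 2 \<longleftrightarrow> \<not> e1"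
      using at by (auto simp: vertex_out_def split: if_splits)
    then show ?thesis using iff' 1 by (cases e1) auto
  next
    case 2
    then have "?\<sigma>' p = 2 \<longleftrightarrow> \<not> e2" "?\<sigma>' (p + 1) = 2 \<longleftrightarrow> e2"
      using at by (auto simp: vertex_out_def split: if_splits)
    then show ?thesis using iff' 2 by (cases e2) auto
  next
    case 3
    then have "?\<sigma>' = \<sigma>" by (auto simp: cross_def vertex_out_def)
    then show ?thesis using iff' 3 by auto
  qed
qed

section \<open>The merged history\<close>

definition hist ::
  "(nat \<Rightarrow> int \<times> nat) \<Rightarrow> (int \<Rightarrow> ereal) \<Rightarrow> (int \<Rightarrow> nat \<Rightarrow> bool) \<Rightarrow> (int \<Rightarrow> nat \<Rightarrow> bool) \<Rightarrow> nat \<Rightarrow>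
   (int \<Rightarrow> ereal) list" where
  "hist u eta c1 c2 n = map (\<lambda>k. merge_class \<circ> front u eta c1 c2 k) [0..<Suc n]"

lemma hist_0: "hist u eta c1 c2 0 = [merge_class \<circ> eta]"
  by (simp add: hist_def)

lemma hist_Suc: "hist u eta c1 c2 (Suc n) = hist u eta c1 c2 n @ [merge_class \<circ> front u eta c1 c2 (Suc n)]"
  by (simp add: hist_def)

lemma length_hist [simp]: "length (hist u eta c1 c2 n) = Suc n"
  by (simp add: hist_def)

lemma last_hist: "last (hist u eta c1 c2 n) = merge_class \<circ> front u eta c1 c2 n"
  by (simp add: hist_def)

lemma nth_hist: "k \<le> n \<Longrightarrow> hist u eta c1 c2 n ! k = merge_class \<circ> front u eta c1 c2 k"
  unfolding hist_def by (simp add: less_Suc_eq_le del: upt_Suc)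

text \<open>Each step reads two bits, so only finitely many fronts occur. Sums over merged histories
  are finite for the same reason.\<close>

lemma finite_range_front: "finite {front u eta c1 c2 n | c1 c2. True}"
proof (induction n)
  case (Suc n)
  obtain x s where u: "u n = (x, s)" by (cases "u n")
  have "{front u eta c1 c2 (Suc n) | c1 c2. True} \<subseteq>
    (\<lambda>(e1, e2, \<sigma>). cross e1 e2 (x - int s - 1) \<sigma>) ` (UNIV \<times> UNIV \<times> {front u eta c1 c2 n | c1 c2. True})"
    by (force simp: u image_iff)
  then show ?case using Suc finite_subset by fastforce
qed simp

lemma finite_range_hist: "finite {hist u eta c1 c2 n | c1 c2. True}"
proof (induction n)
  case 0
  have "{hist u eta c1 c2 0 | c1 c2. True} \<subseteq> {[merge_class \<circ> eta]}" by (auto simp: hist_0)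
  then show ?case using finite_subset by blast
next
  case (Suc n)
  have "{hist u eta c1 c2 (Suc n) | c1 c2. True} \<subseteq>
    (\<lambda>(l, \<sigma>). l @ [merge_class \<circ> \<sigma>]) `
      ({hist u eta c1 c2 n | c1 c2. True} \<times> {front u eta c1 c2 (Suc n) | c1 c2. True})"
    unfolding hist_Suc by fastforce
  then show ?case using Suc finite_range_front[of u eta "Suc n"] finite_subset by fastforce
qed

section \<open>Functions of the variables at a given set of vertices\<close>

definition depends_on ::
  "((int \<Rightarrow> nat \<Rightarrow> bool) \<Rightarrow> (int \<Rightarrow> nat \<Rightarrow> bool) \<Rightarrow> 'b) \<Rightarrow> (int \<times> nat) set \<Rightarrow> bool" where
  "depends_on \<phi> J \<longleftrightarrow>
    (\<forall>c1 c2 d1 d2. (\<forall>(x, s)\<in>J. c1 x s = d1 x s \<and> c2 x s = d2 x s) \<longrightarrow> \<phi> c1 c2 = \<phi> d1 d2)"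

lemma depends_onI:
  assumes "\<And>c1 c2 d1 d2. (\<And>x s. (x, s) \<in> J \<Longrightarrow> c1 x s = d1 x s \<and> c2 x s = d2 x s) \<Longrightarrow> \<phi> c1 c2 = \<phi> d1 d2"
  shows "depends_on \<phi> J"
  unfolding depends_on_def
proof (intro allI impI)
  fix c1 c2 d1 d2 :: "int \<Rightarrow> nat \<Rightarrow> bool"
  assume "\<forall>(x, s)\<in>J. c1 x s = d1 x s \<and> c2 x s = d2 x s"
  then show "\<phi> c1 c2 = \<phi> d1 d2" by (intro assms) auto
qed

lemma depends_onD:
  assumes "depends_on \<phi> J" and "\<And>x s. (x, s) \<in> J \<Longrightarrow> c1 x s = d1 x s \<and> c2 x s = d2 x s"
  shows "\<phi> c1 c2 = \<phi> d1 d2"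
proof -
  have "\<forall>(x, s)\<in>J. c1 x s = d1 x s \<and> c2 x s = d2 x s" using assms(2) by auto
  then show ?thesis using assms(1) unfolding depends_on_def by blast
qed

lemma depends_on_mono:
  assumes "depends_on \<phi> I" "I \<subseteq> J"
  shows "depends_on \<phi> J"
  by (rule depends_onI, rule depends_onD[OF assms(1)]) (use assms(2) in blast)

lemma depends_on_comp2:
  assumes "depends_on \<phi> J" "depends_on \<psi> J"
  shows "depends_on (\<lambda>c1 c2. g (\<phi> c1 c2) (\<psi> c1 c2)) J"
  by (rule depends_onI, rule arg_cong2[where f = g])
    (rule depends_onD[OF assms(1)] depends_onD[OF assms(2)]; blast)+

lemma depends_on_comp: "depends_on \<phi> J \<Longrightarrow> depends_on (\<lambda>c1 c2. g (\<phi> c1 c2)) J"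
  using depends_on_comp2[of \<phi> J \<phi> "\<lambda>x y. g x"] by simp

text \<open>The first \<open>n\<close> steps read only \<open>u 0, ..., u (n - 1)\<close>. For
  injective \<open>u\<close> the variables read at step \<open>n\<close> are thus independent of the
  front so far.\<close>

lemma depends_on_front: "depends_on (\<lambda>c1 c2. front u eta c1 c2 n) (u ` {..<n})"
proof (induction n)
  case 0
  show ?case unfolding depends_on_def by simp
next
  case (Suc n)
  obtain x s where u: "u n = (x, s)" by (cases "u n")
  have f: "depends_on (\<lambda>c1 c2. front u eta c1 c2 n) (u ` {..<Suc n})"
    using Suc by (rule depends_on_mono) auto
  have "u n \<in> u ` {..<Suc n}" by auto
  then have c: "depends_on (\<lambda>c1 c2. (c1 x s, c2 x s)) (u ` {..<Suc n})"
    by (intro depends_onI) (auto simp: u)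
  show ?case
    using depends_on_comp2[OF c f, of "\<lambda>(e1, e2). cross e1 e2 (x - int s - 1)"] by (simp add: u)
qed

lemma depends_on_hist: "depends_on (\<lambda>c1 c2. hist u eta c1 c2 n) (u ` {..<n})"
proof (induction n)
  case 0
  show ?case unfolding depends_on_def hist_0 by simp
next
  case (Suc n)
  have f: "depends_on (\<lambda>c1 c2. hist u eta c1 c2 n) (u ` {..<Suc n})"
    using Suc by (rule depends_on_mono) auto
  show ?case unfolding hist_Suc
    using depends_on_comp2[OF f depends_on_front, of "\<lambda>l \<sigma>. l @ [merge_class \<circ> \<sigma>]"] by simp
qed

section \<open>The rank of the second-class particle given the merged history\<close>

context stochastic_six_vertex
begin

section \<open>Events of the vertex variables and their independence\<close>

definition chi_event :: "((int \<Rightarrow> nat \<Rightarrow> bool) \<Rightarrow> (int \<Rightarrow> nat \<Rightarrow> bool) \<Rightarrow> bool) \<Rightarrow> 'w set" where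
  "chi_event \<phi> = {w \<in> space P. \<phi> (\<lambda>x s. chi1 x s w) (\<lambda>x s. chi2 x s w)}"

text \<open>A finite product of discrete spaces is discrete, so every condition on the variables at
  finitely many vertices is measurable in their joint value.\<close>

lemma chi_event_eq_vimage:
  fixes J :: "(int \<times> nat) set"
  assumes J: "finite J" "depends_on \<phi> J"
  defines "I \<equiv> Inl ` J \<union> Inr ` J"
    and "X \<equiv> case_sum (\<lambda>(x, t). chi1 x t) (\<lambda>(x, t). chi2 x t)"
  obtains B where "B \<in> sets (PiM I (\<lambda>_. count_space UNIV))"
    and "chi_event \<phi> = (\<lambda>w. restrict (\<lambda>i. X i w) I) -` B \<inter> space P"
proof
  let ?B = "{g \<in> PiE I (\<lambda>_. UNIV). \<phi> (\<lambda>x s. g (Inl (x, s))) (\<lambda>x s. g (Inr (x, s)))}"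
  have fin: "finite I" using J by (simp add: I_def)
  have "PiM I (\<lambda>_. count_space (UNIV :: bool set)) = count_space (PiE I (\<lambda>_. UNIV))"
    by (rule count_space_PiM_finite[OF fin]) simp
  then show "?B \<in> sets (PiM I (\<lambda>_. count_space UNIV))" by auto
  have "\<phi> (\<lambda>x s. restrict (\<lambda>i. X i w) I (Inl (x, s))) (\<lambda>x s. restrict (\<lambda>i. X i w) I (Inr (x, s))) =
      \<phi> (\<lambda>x s. chi1 x s w) (\<lambda>x s. chi2 x s w)" for w
    by (rule depends_onD[OF J(2)]) (auto simp: I_def X_def)
  then show "chi_event \<phi> = (\<lambda>w. restrict (\<lambda>i. X i w) I) -` ?B \<inter> space P"
    by (auto simp: chi_event_def)
qed

lemma random_variable_chi:
  "random_variable (count_space UNIV) (chi1 x s)" "random_variable (count_space UNIV) (chi2 x s)"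
proof -
  have X: "random_variable (count_space UNIV) (case_sum (\<lambda>(x, t). chi1 x t) (\<lambda>(x, t). chi2 x t) i)" for i
    using indep_chi unfolding indep_vars_def by blast
  show "random_variable (count_space UNIV) (chi1 x s)" "random_variable (count_space UNIV) (chi2 x s)"
    using X[of "Inl (x, s)"] X[of "Inr (x, s)"] by simp_all
qed

lemma chi_event_indep:
  assumes J: "finite J" "depends_on \<phi> J" and K: "finite K" "depends_on \<psi> K" and disj: "J \<inter> K = {}"
  shows "prob (chi_event (\<lambda>c1 c2. \<phi> c1 c2 \<and> \<psi> c1 c2)) = prob (chi_event \<phi>) * prob (chi_event \<psi>)"
proof -
  define X where "X = case_sum (\<lambda>(x, t). chi1 x t) (\<lambda>(x, t). chi2 x t)"
  let ?I = "\<lambda>J. Inl ` J \<union> Inr ` J :: ((int \<times> nat) + (int \<times> nat)) set"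
  obtain B where B: "B \<in> sets (PiM (?I J) (\<lambda>_. count_space UNIV))"
      "chi_event \<phi> = (\<lambda>w. restrict (\<lambda>i. X i w) (?I J)) -` B \<inter> space P"
    using chi_event_eq_vimage[OF J] unfolding X_def by metis
  obtain C where C: "C \<in> sets (PiM (?I K) (\<lambda>_. count_space UNIV))"
      "chi_event \<psi> = (\<lambda>w. restrict (\<lambda>i. X i w) (?I K)) -` C \<inter> space P"
    using chi_event_eq_vimage[OF K] unfolding X_def by metis
  have "indep_var (PiM (?I J) (\<lambda>_. count_space UNIV)) (\<lambda>w. restrict (\<lambda>i. X i w) (?I J))
      (PiM (?I K) (\<lambda>_. count_space UNIV)) (\<lambda>w. restrict (\<lambda>i. X i w) (?I K))"
    using indep_chi disj unfolding X_def by (intro indep_var_restrict) auto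
  from indep_varD[OF this B(1) C(1)]
  have "prob ((\<lambda>w. (restrict (\<lambda>i. X i w) (?I J), restrict (\<lambda>i. X i w) (?I K))) -` (B \<times> C) \<inter> space P) =
      prob (chi_event \<phi>) * prob (chi_event \<psi>)"
    unfolding B(2) C(2) .
  moreover have "chi_event (\<lambda>c1 c2. \<phi> c1 c2 \<and> \<psi> c1 c2) = chi_event \<phi> \<inter> chi_event \<psi>"
    by (auto simp: chi_event_def)
  moreover have "(\<lambda>w. (restrict (\<lambda>i. X i w) (?I J), restrict (\<lambda>i. X i w) (?I K))) -` (B \<times> C) \<inter> space P =
      chi_event \<phi> \<inter> chi_event \<psi>"
    unfolding B(2) C(2) by auto
  ultimately show ?thesis by simp
qed

lemma chi_event_measurable:
  assumes "finite J" "depends_on \<phi> J"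
  shows "chi_event \<phi> \<in> events"
proof -
  define X where "X = case_sum (\<lambda>(x, t). chi1 x t) (\<lambda>(x, t). chi2 x t)"
  let ?I = "Inl ` J \<union> Inr ` J :: ((int \<times> nat) + (int \<times> nat)) set"
  obtain B where B: "B \<in> sets (PiM ?I (\<lambda>_. count_space UNIV))"
      "chi_event \<phi> = (\<lambda>w. restrict (\<lambda>i. X i w) ?I) -` B \<inter> space P"
    using chi_event_eq_vimage[OF assms] unfolding X_def by metis
  have "random_variable (count_space UNIV) (X i)" for i
    by (auto simp: X_def random_variable_chi split: sum.split)
  then have "(\<lambda>w. restrict (\<lambda>i. X i w) ?I) \<in> measurable P (PiM ?I (\<lambda>_. count_space UNIV))"
    by (intro measurable_restrict)
  then show ?thesis unfolding B(2) using B(1) by (rule measurable_sets)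
qed

lemma prob_chi:
  assumes "0 \<le> b1" "b1 \<le> 1" "0 \<le> b2" "b2 \<le> 1"
  shows "prob (chi_event (\<lambda>c1 c2. c1 x s)) = b1" "prob (chi_event (\<lambda>c1 c2. c2 x s)) = b2"
proof -
  have "prob (chi_event (\<lambda>c1 c2. c1 x s)) = measure (distr P (count_space UNIV) (chi1 x s)) {True}"
    unfolding chi_event_def using random_variable_chi(1)[of x s]
    by (subst measure_distr) (auto intro!: arg_cong[where f = prob])
  also have "\<dots> = b1" using assms by (simp add: distr_chi1 measure_pmf_single)
  finally show "prob (chi_event (\<lambda>c1 c2. c1 x s)) = b1" .
  have "prob (chi_event (\<lambda>c1 c2. c2 x s)) = measure (distr P (count_space UNIV) (chi2 x s)) {True}"
    unfolding chi_event_def using random_variable_chi(2)[of x s]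
    by (subst measure_distr) (auto intro!: arg_cong[where f = prob])
  also have "\<dots> = b2" using assms by (simp add: distr_chi2 measure_pmf_single)
  finally show "prob (chi_event (\<lambda>c1 c2. c2 x s)) = b2" .
qed

lemma prob_chi_event_complement:
  assumes "finite J" "depends_on \<phi> J"
  shows "prob (chi_event (\<lambda>c1 c2. \<not> \<phi> c1 c2)) = 1 - prob (chi_event \<phi>)"
proof -
  have "chi_event (\<lambda>c1 c2. \<not> \<phi> c1 c2) = space P - chi_event \<phi>"
    by (auto simp: chi_event_def)
  then show ?thesis using prob_compl[OF chi_event_measurable[OF assms]] by simp
qed

lemma prob_chi_event_split:
  assumes J: "finite J" "depends_on \<phi> J" and K: "finite K" "depends_on \<psi> K"
  shows "prob (chi_event \<phi>) =
    prob (chi_event (\<lambda>c1 c2. \<phi> c1 c2 \<and> \<psi> c1 c2)) + prob (chi_event (\<lambda>c1 c2. \<phi> c1 c2 \<and> \<not> \<psi> c1 c2))"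
proof -
  have m: "chi_event \<phi> \<in> events" "chi_event \<psi> \<in> events"
    using assms chi_event_measurable by auto
  have "chi_event (\<lambda>c1 c2. \<phi> c1 c2 \<and> \<psi> c1 c2) = chi_event \<phi> \<inter> chi_event \<psi>"
    "chi_event (\<lambda>c1 c2. \<phi> c1 c2 \<and> \<not> \<psi> c1 c2) = chi_event \<phi> - chi_event \<psi>"
    by (auto simp: chi_event_def)
  then show ?thesis using finite_measure_Diff'[OF m] by simp
qed

text \<open>
  Given the history of the merged process, an update of neighbouring particles with ranks
  \<open>r\<close> and \<open>Suc r\<close> changes only the tail probability at \<open>Suc r\<close>. The tails themselves staying below
  \<open>q ^ k\<close> is not inductive when \<open>b1 + b2 > 1\<close>; the ratio bound below is.
\<close>

lemma tail_ratio_update: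
  fixes p p' :: "nat \<Rightarrow> real"
  assumes b: "0 < b1" "b1 < b2" "b2 < 1" and q: "q = b1 / b2"
    and p: "\<And>i. p (Suc i) \<le> q * p i"
    and other: "\<And>i. i \<noteq> Suc r \<Longrightarrow> p' i = p i"
    and new: "p' (Suc r) = p (Suc (Suc r)) + (1 - b2) * (p (Suc r) - p (Suc (Suc r))) + b1 * (p r - p (Suc r))"
  shows "p' (Suc i) \<le> q * p' i"
proof -
  have b2q: "b2 * q = b1" using b q by simp
  have q0: "0 < q" using b q by simp
  \<comment> \<open>In \<open>new\<close> the total coefficient of \<open>p (Suc r)\<close> is
    \<open>1 - b1 - b2\<close>, which may be negative. Trading \<open>b2 * p (Suc (Suc r))\<close>
    for \<open>b1 * p (Suc r)\<close> raises it to \<open>1 - b2 > 0\<close>, and then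
    \<open>p (Suc r)\<close> may be replaced by \<open>q * p r\<close>.\<close>
  have "b2 * p (Suc (Suc r)) \<le> b1 * p (Suc r)"
    using mult_left_mono[OF p[of "Suc r"], of b2] b b2q by (simp add: mult.assoc[symmetric])
  then have "p' (Suc r) \<le> b1 * p r + (1 - b2) * p (Suc r)"
    unfolding new by (simp add: algebra_simps)
  also have "\<dots> \<le> b1 * p r + (1 - b2) * (q * p r)"
    using p[of r] b by (intro add_left_mono mult_left_mono) auto
  also have "\<dots> = q * p r" using b2q by (simp add: algebra_simps)
  finally have upper: "p' (Suc r) \<le> q * p r" .
  \<comment> \<open>The same trade one index lower makes the coefficient \<open>1 - b1\<close> in
    the lower bound.\<close>
  have "b2 * p (Suc r) \<le> b1 * p r"
    using mult_left_mono[OF p[of "r"], of b2] b b2q by (simp add: mult.assoc[symmetric])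
  then have "b2 * p (Suc (Suc r)) + (1 - b1) * p (Suc r) \<le> p' (Suc r)"
    unfolding new by (simp add: algebra_simps)
  then have "q * (b2 * p (Suc (Suc r)) + (1 - b1) * p (Suc r)) \<le> q * p' (Suc r)"
    using q0 by (intro mult_left_mono) auto
  moreover have "q * (b2 * p (Suc (Suc r)) + (1 - b1) * p (Suc r)) =
      (b2 * q) * p (Suc (Suc r)) + (1 - b1) * (q * p (Suc r))"
    by (simp add: algebra_simps)
  moreover have "(1 - b1) * p (Suc (Suc r)) \<le> (1 - b1) * (q * p (Suc r))"
    using p[of "Suc r"] b by (intro mult_left_mono) auto
  moreover have "p (Suc (Suc r)) = b1 * p (Suc (Suc r)) + (1 - b1) * p (Suc (Suc r))"
    by (simp add: algebra_simps)
  ultimately have lower: "p (Suc (Suc r)) \<le> q * p' (Suc r)" unfolding b2q by linarith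
  consider "i = r" | "i = Suc r" | "i \<noteq> r" "i \<noteq> Suc r" by blast
  then show ?thesis
    by cases (use upper lower p[of i] other in auto)
qed

text \<open>A joint probability, so histories of probability zero cause no trouble. Dividing by
  \<open>tail u n l 0\<close> gives the conditional tail of the rank.\<close>

definition tail :: "(nat \<Rightarrow> int \<times> nat) \<Rightarrow> nat \<Rightarrow> (int \<Rightarrow> ereal) list \<Rightarrow> nat \<Rightarrow> real" where
  "tail u n l i = prob (chi_event (\<lambda>c1 c2.
     i \<le> thirds_right_of_second (front u eta0 c1 c2 n) \<and> hist u eta0 c1 c2 n = l))"

text \<open>Induction on the number of steps. If the last vertex does not join two merged particles,
  it contributes a factor independent of the past. If it does, the merged configuration stays as it
  is and the tails change as in \<open>tail_ratio_update\<close>. Impossible histories give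
  zero.\<close>

lemma tail_ratio:
  assumes b: "0 < b1" "b1 < b2" "b2 < 1" and q: "q = b1 / b2"
    and u: "inj u" and adm: "admissible eta0"
    and init: "\<And>x y. eta0 x = 3 \<Longrightarrow> eta0 y = 2 \<Longrightarrow> x < y"
  shows "tail u n l (Suc i) \<le> q * tail u n l i"
proof (induction n arbitrary: l i)
  case 0
  have "thirds_right_of_second eta0 = 0"
  proof -
    have "{x. eta0 x = 3 \<and> (\<exists>y. eta0 y = 2 \<and> y < x)} = {}" using init by (auto dest: less_asym)
    then show ?thesis unfolding thirds_right_of_second_def by (simp only: card.empty)
  qed
  then have "tail u 0 l (Suc i) = 0" by (simp add: tail_def chi_event_def)
  then show ?case using b q by (simp add: tail_def)
next
  case (Suc n)
  show ?case
  proof (cases "length l = Suc (Suc n)")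
    case False
    then have "hist u eta0 c1 c2 (Suc n) \<noteq> l" for c1 c2
      using length_hist[of u eta0 c1 c2 "Suc n"] by metis
    then show ?thesis by (simp add: tail_def chi_event_def)
  next
    case True
    then obtain l' m where l: "l = l' @ [m]" by (metis length_Suc_conv_rev)
    obtain x s where xs: "u n = (x, s)" by (cases "u n")
    define p where "p = x - int s - 1"
    define \<mu> where "\<mu> = last l'"
    let ?K = "\<lambda>c1 c2 n. thirds_right_of_second (front u eta0 c1 c2 n)"
    let ?h = "\<lambda>c1 c2 n. hist u eta0 c1 c2 n"
    have front_Suc: "front u eta0 c1 c2 (Suc n) = cross (c1 x s) (c2 x s) p (front u eta0 c1 c2 n)"
      for c1 c2 by (simp add: xs p_def)
    have hist_eq: "?h c1 c2 (Suc n) = l \<longleftrightarrow>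
        ?h c1 c2 n = l' \<and> merge_class \<circ> cross (c1 x s) (c2 x s) p (front u eta0 c1 c2 n) = m" for c1 c2
      unfolding hist_Suc l front_Suc by simp
    have \<mu>: "merge_class \<circ> front u eta0 c1 c2 n = \<mu>" if "?h c1 c2 n = l'" for c1 c2
      using last_hist[of u eta0 c1 c2 n] that by (simp add: \<mu>_def)
    have adm_front: "admissible (front u eta0 c1 c2 n)" for c1 c2
      by (rule admissible_front[OF adm])
    have dep: "depends_on (\<lambda>c1 c2. Q (?K c1 c2 n) \<and> ?h c1 c2 n = l') (u ` {..<n})" for Q
      using depends_on_comp2[OF depends_on_front depends_on_hist,
          of "\<lambda>\<sigma> h. Q (thirds_right_of_second \<sigma>) \<and> h = l'" u eta0 n] .
    have fin: "finite (u ` {..<n})" by simp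
    have new: "u ` {..<n} \<inter> {(x, s)} = {}"
      using injD[OF u] xs by force
    show ?thesis
    proof (cases "\<mu> p = 2 \<and> \<mu> (p + 1) = 2")
      case False
      have K': "?K c1 c2 (Suc n) = ?K c1 c2 n" and
        m': "merge_class \<circ> cross (c1 x s) (c2 x s) p (front u eta0 c1 c2 n) = cross (c1 x s) (c2 x s) p \<mu>"
        if "?h c1 c2 n = l'" for c1 c2
      proof -
        have n2: "\<not> (merge_class (front u eta0 c1 c2 n p) = 2 \<and> merge_class (front u eta0 c1 c2 n (p + 1)) = 2)"
          using False \<mu>[OF that] by auto
        show "?K c1 c2 (Suc n) = ?K c1 c2 n"
          unfolding front_Suc by (rule thirds_right_cross_nonpair[OF n2])
        show "merge_class \<circ> cross (c1 x s) (c2 x s) p (front u eta0 c1 c2 n) = cross (c1 x s) (c2 x s) p \<mu>"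
          using merge_cross_nonpair[OF adm_front n2] \<mu>[OF that] by simp
      qed
      \<comment> \<open>With the past configuration fixed to \<open>\<mu>\<close>, reaching
        \<open>m\<close> is a condition on the fresh vertex alone, while the rank does not
        move.\<close>
      define D where "D c1 c2 \<longleftrightarrow> cross (c1 x s) (c2 x s) p \<mu> = m" for c1 c2 :: "int \<Rightarrow> nat \<Rightarrow> bool"
      have D: "depends_on D {(x, s)}"
        by (intro depends_onI) (auto simp: D_def)
      have "tail u (Suc n) l j = tail u n l' j * prob (chi_event D)" for j
      proof -
        have "j \<le> ?K c1 c2 (Suc n) \<and> ?h c1 c2 (Suc n) = l \<longleftrightarrow>
            (j \<le> ?K c1 c2 n \<and> ?h c1 c2 n = l') \<and> D c1 c2" for c1 c2
          by (cases "?h c1 c2 n = l'") (simp_all add: hist_eq K' m' D_def del: front.simps)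
        then show ?thesis
          unfolding tail_def using chi_event_indep[OF fin dep _ D new, of "\<lambda>k. j \<le> k"] by simp
      qed
      then show ?thesis
        using Suc.IH[of l' i] mult_right_mono[OF Suc.IH[of l' i], of "prob (chi_event D)"]
        by (simp add: mult.assoc)
    next
      case True
      \<comment> \<open>Since \<open>r\<close> is read off from \<open>\<mu>\<close>, it is the same
        for all realisations with history \<open>l'\<close>.\<close>
      define r where "r = card {y. p + 1 < y \<and> \<mu> y = 2}"
      have pair: "merge_class (front u eta0 c1 c2 n p) = 2" "merge_class (front u eta0 c1 c2 n (p + 1)) = 2"
          "r = card {y. p + 1 < y \<and> merge_class (front u eta0 c1 c2 n y) = 2}"
        if "?h c1 c2 n = l'" for c1 c2
        using True \<mu>[OF that] unfolding r_def by (auto simp: fun_eq_iff simp del: merge_class_eq_2_iff)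
      have m': "merge_class \<circ> cross (c1 x s) (c2 x s) p (front u eta0 c1 c2 n) = \<mu>"
        if "?h c1 c2 n = l'" for c1 c2
        using merge_cross_pair[OF pair(1,2)[OF that]] \<mu>[OF that] by simp
      have K': "?K c1 c2 (Suc n) = (if ?K c1 c2 n = r \<and> c1 x s then Suc r
          else if ?K c1 c2 n = Suc r \<and> c2 x s then r else ?K c1 c2 n)" if "?h c1 c2 n = l'" for c1 c2
        unfolding front_Suc by (rule thirds_right_cross_pair[OF adm_front pair[OF that]])
      show ?thesis
      proof (cases "m = \<mu>")
        case False
        then have "hist u eta0 c1 c2 (Suc n) \<noteq> l" for c1 c2
          using hist_eq m' by metis
        then show ?thesis by (simp add: tail_def chi_event_def)
      next
        case mu: True
        have h: "?h c1 c2 (Suc n) = l \<longleftrightarrow> ?h c1 c2 n = l'" for c1 c2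
          using hist_eq m' mu by metis
        let ?E = "\<lambda>Q. prob (chi_event (\<lambda>c1 c2. Q (?K c1 c2 n) \<and> ?h c1 c2 n = l'))"
        have exact: "?E (\<lambda>k. k = j) = tail u n l' j - tail u n l' (Suc j)" for j
        proof -
          have "chi_event (\<lambda>c1 c2. (j \<le> ?K c1 c2 n \<and> ?h c1 c2 n = l') \<and> (Suc j \<le> ?K c1 c2 n \<and> ?h c1 c2 n = l')) =
              chi_event (\<lambda>c1 c2. Suc j \<le> ?K c1 c2 n \<and> ?h c1 c2 n = l')"
            "chi_event (\<lambda>c1 c2. (j \<le> ?K c1 c2 n \<and> ?h c1 c2 n = l') \<and> \<not> (Suc j \<le> ?K c1 c2 n \<and> ?h c1 c2 n = l')) =
              chi_event (\<lambda>c1 c2. ?K c1 c2 n = j \<and> ?h c1 c2 n = l')"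
            by (auto simp: chi_event_def)
          then show ?thesis
            using prob_chi_event_split[OF fin dep[of "\<lambda>k. j \<le> k"] fin dep[of "\<lambda>k. Suc j \<le> k"]]
            by (simp add: tail_def)
        qed
        have c: "depends_on (\<lambda>c1 c2. c1 x s) {(x, s)}" "depends_on (\<lambda>c1 c2. \<not> c2 x s) {(x, s)}"
            "depends_on (\<lambda>c1 c2. c2 x s) {(x, s)}"
          by (intro depends_onI; simp)+
        have p1: "prob (chi_event (\<lambda>c1 c2. c1 x s)) = b1"
          and p2: "prob (chi_event (\<lambda>c1 c2. \<not> c2 x s)) = 1 - b2"
          using prob_chi[of x s] prob_chi_event_complement[OF _ c(3)] b by auto
        have other: "tail u (Suc n) l j = tail u n l' j" if "j \<noteq> Suc r" for j
        proof -
          have "j \<le> ?K c1 c2 (Suc n) \<and> ?h c1 c2 n = l' \<longleftrightarrow> j \<le> ?K c1 c2 n \<and> ?h c1 c2 n = l'" for c1 c2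
            using K'[of c1 c2] that by (cases "?h c1 c2 n = l'") (auto simp del: front.simps)
          then show ?thesis unfolding tail_def h by (simp del: front.simps)
        qed
        have upd: "tail u (Suc n) l (Suc r) = tail u n l' (Suc (Suc r)) +
            (1 - b2) * (tail u n l' (Suc r) - tail u n l' (Suc (Suc r))) +
            b1 * (tail u n l' r - tail u n l' (Suc r))"
        proof -
          let ?A = "chi_event (\<lambda>c1 c2. Suc (Suc r) \<le> ?K c1 c2 n \<and> ?h c1 c2 n = l')"
          let ?B = "chi_event (\<lambda>c1 c2. (?K c1 c2 n = Suc r \<and> ?h c1 c2 n = l') \<and> \<not> c2 x s)"
          let ?C = "chi_event (\<lambda>c1 c2. (?K c1 c2 n = r \<and> ?h c1 c2 n = l') \<and> c1 x s)"
          \<comment> \<open>The new rank is at least \<open>Suc r\<close> if the old one was larger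
            than \<open>Suc r\<close>, or was \<open>Suc r\<close> without a step back, or was
            \<open>r\<close> with a step up.\<close>
          have "Suc r \<le> ?K c1 c2 (Suc n) \<longleftrightarrow> Suc (Suc r) \<le> ?K c1 c2 n \<or>
              ?K c1 c2 n = Suc r \<and> \<not> c2 x s \<or> ?K c1 c2 n = r \<and> c1 x s" if "?h c1 c2 n = l'" for c1 c2
            using K'[OF that] by (auto split: if_splits simp del: front.simps)
          then have "chi_event (\<lambda>c1 c2. Suc r \<le> ?K c1 c2 (Suc n) \<and> ?h c1 c2 (Suc n) = l) = ?A \<union> ?B \<union> ?C"
            unfolding h chi_event_def by blast
          moreover have "?A \<inter> ?B = {}" "(?A \<union> ?B) \<inter> ?C = {}" by (auto simp: chi_event_def)
          moreover have "?A \<in> events"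
            by (rule chi_event_measurable[OF fin dep[of "\<lambda>k. Suc (Suc r) \<le> k"]])
          moreover have "?B \<in> events"
            using depends_on_comp2[OF depends_on_mono[OF dep[of "\<lambda>k. k = Suc r"], of "u ` {..<n} \<union> {(x, s)}"]
              depends_on_mono[OF c(2), of "u ` {..<n} \<union> {(x, s)}"], of "(\<and>)"]
            by (intro chi_event_measurable[of "u ` {..<n} \<union> {(x, s)}"]) auto
          moreover have "?C \<in> events"
            using depends_on_comp2[OF depends_on_mono[OF dep[of "\<lambda>k. k = r"], of "u ` {..<n} \<union> {(x, s)}"]
              depends_on_mono[OF c(1), of "u ` {..<n} \<union> {(x, s)}"], of "(\<and>)"]
            by (intro chi_event_measurable[of "u ` {..<n} \<union> {(x, s)}"]) auto
          ultimately have "tail u (Suc n) l (Suc r) = prob ?A + prob ?B + prob ?C"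
            unfolding tail_def by (simp add: finite_measure_Union)
          moreover have "prob ?B = (tail u n l' (Suc r) - tail u n l' (Suc (Suc r))) * (1 - b2)"
            using chi_event_indep[OF fin dep[of "\<lambda>k. k = Suc r"] _ c(2) new] exact[of "Suc r"] p2 by simp
          moreover have "prob ?C = (tail u n l' r - tail u n l' (Suc r)) * b1"
            using chi_event_indep[OF fin dep[of "\<lambda>k. k = r"] _ c(1) new] exact[of r] p1 by simp
          ultimately show ?thesis by (simp add: tail_def mult.commute)
        qed
        show ?thesis
          by (rule tail_ratio_update[where p = "tail u n l'" and p' = "tail u (Suc n) l" and r = r,
                OF b q Suc.IH other upd])
      qed
    qed
  qed
qed

text \<open>Iterating the ratio bound gives the tail bound for a single history; summing over the
  finitely many possible histories in \<open>S\<close> gives it for every event of the merged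
  process.\<close>

lemma prob_thirds_right_and_hist:
  assumes b: "0 < b1" "b1 < b2" "b2 < 1" and q: "q = b1 / b2"
    and u: "inj u" and adm: "admissible eta0"
    and init: "\<And>x y. eta0 x = 3 \<Longrightarrow> eta0 y = 2 \<Longrightarrow> x < y"
  shows "prob (chi_event (\<lambda>c1 c2. k \<le> thirds_right_of_second (front u eta0 c1 c2 n) \<and>
      hist u eta0 c1 c2 n \<in> S)) \<le> q ^ k * prob (chi_event (\<lambda>c1 c2. hist u eta0 c1 c2 n \<in> S))"
proof -
  let ?R = "S \<inter> {hist u eta0 c1 c2 n | c1 c2. True}"
  have fin: "finite ?R" using finite_range_hist[of u eta0 n] by simp
  have tail_le: "tail u n l k \<le> q ^ k * tail u n l 0" for l
  proof (induction k)
    case (Suc k)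
    have "tail u n l (Suc k) \<le> q * tail u n l k"
      by (rule tail_ratio[OF b q u adm init])
    also have "\<dots> \<le> q * (q ^ k * tail u n l 0)"
      using Suc b q by (intro mult_left_mono) auto
    finally show ?case by (simp add: mult.assoc)
  qed simp
  have decomp: "prob (chi_event (\<lambda>c1 c2. j \<le> thirds_right_of_second (front u eta0 c1 c2 n) \<and>
      hist u eta0 c1 c2 n \<in> S)) = (\<Sum>l\<in>?R. tail u n l j)" for j
  proof -
    let ?E = "\<lambda>l. chi_event (\<lambda>c1 c2. j \<le> thirds_right_of_second (front u eta0 c1 c2 n) \<and> hist u eta0 c1 c2 n = l)"
    have "chi_event (\<lambda>c1 c2. j \<le> thirds_right_of_second (front u eta0 c1 c2 n) \<and> hist u eta0 c1 c2 n \<in> S) =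
        (\<Union>l\<in>?R. ?E l)"
      by (auto simp: chi_event_def)
    moreover have "?E l \<in> events" for l
      using depends_on_comp2[OF depends_on_front depends_on_hist,
          of "\<lambda>\<sigma> h. j \<le> thirds_right_of_second \<sigma> \<and> h = l" u eta0 n]
      by (intro chi_event_measurable[of "u ` {..<n}"]) auto
    moreover have "disjoint_family_on ?E ?R" by (auto simp: disjoint_family_on_def chi_event_def)
    ultimately show ?thesis
      unfolding tail_def using finite_measure_finite_Union[OF fin, of ?E] by auto
  qed
  have "(\<Sum>l\<in>?R. tail u n l k) \<le> q ^ k * (\<Sum>l\<in>?R. tail u n l 0)"
    unfolding sum_distrib_left by (intro sum_mono tail_le)
  then show ?thesis using decomp[of k] decomp[of 0] by simp
qed

end

section \<open>Approximation of events\<close>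

context prob_space
begin

section \<open>Approximation in probability by a sequence of algebras\<close>

lemma prob_sym_diff_tendsto_0:
  assumes A: "A \<in> events" and B: "\<And>n. B n \<in> events"
    and ev: "AE w in M. \<forall>\<^sub>F n in sequentially. w \<in> A \<longleftrightarrow> w \<in> B n"
  shows "(\<lambda>n. prob (sym_diff A (B n))) \<longlonglongrightarrow> 0"
proof -
  have D: "sym_diff A (B n) \<in> events" for n using A B by auto
  have "(\<lambda>n. \<integral>w. indicator (sym_diff A (B n)) w \<partial>M) \<longlonglongrightarrow> (\<integral>w. (0::real) \<partial>M)"
  proof (rule integral_dominated_convergence[where w = "\<lambda>_. 1"])
    show "AE w in M. (\<lambda>n. indicator (sym_diff A (B n)) w :: real) \<longlonglongrightarrow> 0"
      using ev
    proof eventually_elim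
      case (elim w)
      then have "\<forall>\<^sub>F n in sequentially. (indicator (sym_diff A (B n)) w :: real) = 0"
        by eventually_elim (auto simp: indicator_def)
      then show ?case by (rule tendsto_eventually)
    qed
    show "indicator (sym_diff A (B n)) \<in> borel_measurable M" for n
      by (intro borel_measurable_indicator D)
    show "AE w in M. norm (indicator (sym_diff A (B n)) w :: real) \<le> 1" for n
      by (auto simp: indicator_def)
  qed simp_all
  then show ?thesis using D by simp
qed

lemma prob_sym_diff_triangle:
  assumes "A \<in> events" "B \<in> events" "C \<in> events"
  shows "prob (sym_diff A C) \<le> prob (sym_diff A B) + prob (sym_diff B C)"
proof -
  have "prob (sym_diff A C) \<le> prob (sym_diff A B \<union> sym_diff B C)"
    using assms by (intro finite_measure_mono) auto
  also have "\<dots> \<le> prob (sym_diff A B) + prob (sym_diff B C)"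
    using assms by (intro measure_Un_le) auto
  finally show ?thesis .
qed

text \<open>The families \<open>F n\<close> need not be nested. Asking for all large
  \<open>n\<close> lets several sets be approximated within the same \<open>F n\<close>.\<close>

definition approximable :: "(nat \<Rightarrow> 'a set set) \<Rightarrow> 'a set \<Rightarrow> bool" where
  "approximable F A \<longleftrightarrow> A \<in> events \<and>
    (\<forall>\<epsilon>>0. \<forall>\<^sub>F n in sequentially. \<exists>B\<in>F n. prob (sym_diff A B) < \<epsilon>)"

lemma approximableI:
  assumes "A \<in> events" and F: "\<And>n. B n \<in> F n" "\<And>n. F n \<subseteq> events"
    and "AE w in M. \<forall>\<^sub>F n in sequentially. w \<in> A \<longleftrightarrow> w \<in> B n"
  shows "approximable F A"
  unfolding approximable_def
proof (intro conjI allI impI)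
  fix \<epsilon> :: real assume "\<epsilon> > 0"
  have "(\<lambda>n. prob (sym_diff A (B n))) \<longlonglongrightarrow> 0"
    using assms by (intro prob_sym_diff_tendsto_0) auto
  then have "\<forall>\<^sub>F n in sequentially. prob (sym_diff A (B n)) < \<epsilon>"
    using \<open>\<epsilon> > 0\<close> by (rule order_tendstoD)
  then show "\<forall>\<^sub>F n in sequentially. \<exists>B\<in>F n. prob (sym_diff A B) < \<epsilon>"
    by eventually_elim (use F in auto)
qed fact

text \<open>Complements and finite unions of approximants stay in the algebra \<open>F n\<close>,
  and a countable union differs from a finite one by a set of small probability.\<close>

lemma approximable_sigma_sets:
  assumes alg: "\<And>n. algebra (space M) (F n)" and F: "\<And>n. F n \<subseteq> events"
    and G: "\<And>A. A \<in> G \<Longrightarrow> approximable F A"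
  shows "A \<in> sigma_sets (space M) G \<Longrightarrow> approximable F A"
proof (induction rule: sigma_sets.induct)
  case (Basic A)
  then show ?case by (rule G)
next
  case Empty
  have "{} \<in> F n" for n using algebra.axioms(1)[OF alg[of n]] by (simp add: ring_of_sets_iff)
  then show ?case by (intro approximableI[of _ "\<lambda>_. {}"] F) auto
next
  case (Compl A)
  then have A: "A \<in> events" by (simp add: approximable_def)
  have "\<exists>C\<in>F n. prob (sym_diff (space M - A) C) < \<epsilon>" if B: "B \<in> F n" "prob (sym_diff A B) < \<epsilon>" for n B \<epsilon>
  proof
    show "space M - B \<in> F n" using alg[of n] B by (simp add: algebra_iff_Un)
    have "sym_diff (space M - A) (space M - B) = sym_diff A B"
      using sets.sets_into_space[OF A] sets.sets_into_space[of B] F[of n] B(1) by auto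
    then show "prob (sym_diff (space M - A) (space M - B)) < \<epsilon>" using B by simp
  qed
  note compl = this
  show ?case
    unfolding approximable_def
  proof (intro conjI allI impI)
    show "space M - A \<in> events" using A by auto
    fix \<epsilon> :: real assume "\<epsilon> > 0"
    then have "\<forall>\<^sub>F n in sequentially. \<exists>B\<in>F n. prob (sym_diff A B) < \<epsilon>"
      using Compl.IH by (simp add: approximable_def)
    then show "\<forall>\<^sub>F n in sequentially. \<exists>B\<in>F n. prob (sym_diff (space M - A) B) < \<epsilon>"
      by eventually_elim (use compl in blast)
  qed
next
  case (Union A)
  have A: "A i \<in> events" for i using Union by (simp add: approximable_def)
  have Un: "approximable F (A \<union> B)" if "approximable F A" "approximable F B" for A B
    unfolding approximable_def
  proof (intro conjI allI impI)
    show "A \<union> B \<in> events" using that by (auto simp: approximable_def)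
    fix \<epsilon> :: real assume "\<epsilon> > 0"
    then have "\<epsilon> / 2 > 0" by simp
    then have "\<forall>\<^sub>F n in sequentially. (\<exists>C\<in>F n. prob (sym_diff A C) < \<epsilon> / 2) \<and> (\<exists>C\<in>F n. prob (sym_diff B C) < \<epsilon> / 2)"
      using that unfolding approximable_def by (intro eventually_conj) blast+
    then show "\<forall>\<^sub>F n in sequentially. \<exists>C\<in>F n. prob (sym_diff (A \<union> B) C) < \<epsilon>"
    proof eventually_elim
      case (elim n)
      then obtain C D where CD: "C \<in> F n" "D \<in> F n" "prob (sym_diff A C) < \<epsilon> / 2" "prob (sym_diff B D) < \<epsilon> / 2"
        by blast
      have ev: "A \<in> events" "B \<in> events" "C \<in> events" "D \<in> events"
        using that CD F by (auto simp: approximable_def)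
      have "prob (sym_diff (A \<union> B) (C \<union> D)) \<le> prob (sym_diff A C \<union> sym_diff B D)"
        using ev by (intro finite_measure_mono) auto
      also have "\<dots> \<le> prob (sym_diff A C) + prob (sym_diff B D)"
        using ev by (intro measure_Un_le) auto
      also have "\<dots> < \<epsilon>" using CD by simp
      finally show ?case using alg[of n] CD(1,2) by (auto simp: algebra_iff_Un)
    qed
  qed
  have fin: "approximable F (\<Union>i\<le>m. A i)" for m
    by (induction m) (use Union.IH Un in \<open>auto simp: atMost_Suc\<close>)
  let ?V = "\<lambda>m. \<Union>i\<le>m. A i"
  have V: "?V m \<in> events" for m using A by auto
  have "(\<lambda>m. prob (sym_diff (\<Union>i. A i) (?V m))) \<longlonglongrightarrow> 0"
  proof (rule prob_sym_diff_tendsto_0)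
    show "AE w in M. \<forall>\<^sub>F n in sequentially. w \<in> (\<Union>i. A i) \<longleftrightarrow> w \<in> ?V n"
    proof (intro AE_I2)
      fix w
      show "\<forall>\<^sub>F n in sequentially. w \<in> (\<Union>i. A i) \<longleftrightarrow> w \<in> ?V n"
      proof (cases "w \<in> (\<Union>i. A i)")
        case True
        then obtain i where "w \<in> A i" by auto
        then show ?thesis by (auto intro!: eventually_mono[OF eventually_ge_at_top[of i]])
      qed auto
    qed
  qed (use A in auto)
  note lim = this
  show ?case
    unfolding approximable_def
  proof (intro conjI allI impI)
    show "(\<Union>i. A i) \<in> events" using A by auto
    fix \<epsilon> :: real assume "\<epsilon> > 0"
    then have "\<epsilon> / 2 > 0" by simp
    then have "\<forall>\<^sub>F m in sequentially. prob (sym_diff (\<Union>i. A i) (?V m)) < \<epsilon> / 2"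
      using order_tendstoD(2)[OF lim, of "\<epsilon> / 2"] by simp
    then obtain m where m: "prob (sym_diff (\<Union>i. A i) (?V m)) < \<epsilon> / 2"
      by (auto simp: eventually_sequentially)
    have "\<forall>\<^sub>F n in sequentially. \<exists>C\<in>F n. prob (sym_diff (?V m) C) < \<epsilon> / 2"
      using fin[of m] \<open>\<epsilon> / 2 > 0\<close> unfolding approximable_def by blast
    then show "\<forall>\<^sub>F n in sequentially. \<exists>C\<in>F n. prob (sym_diff (\<Union>i. A i) C) < \<epsilon>"
    proof eventually_elim
      case (elim n)
      then obtain C where C: "C \<in> F n" "prob (sym_diff (?V m) C) < \<epsilon> / 2" by blast
      have "prob (sym_diff (\<Union>i. A i) C) \<le> prob (sym_diff (\<Union>i. A i) (?V m)) + prob (sym_diff (?V m) C)"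
        using A V F C by (intro prob_sym_diff_triangle) auto
      then show ?case using C m by (intro bexI[of _ C]) auto
    qed
  qed
qed

text \<open>A countable type has countably many finite subsets, and \<open>Q\<close> is constant on
  the infinite ones. This fits \<open>card\<close> and \<open>sorted_list_of_set\<close>, which take
  a default value on infinite sets.\<close>

lemma random_set_predicate_measurable:
  fixes U :: "'a \<Rightarrow> 'b::countable set"
  assumes U: "\<And>x. {w \<in> space M. x \<in> U w} \<in> events"
    and Q: "\<And>S. infinite S \<Longrightarrow> Q S \<longleftrightarrow> Q UNIV"
  shows "{w \<in> space M. Q (U w)} \<in> events"
proof -
  have eq: "{w \<in> space M. U w = S} \<in> events" for S
  proof -
    have "{w \<in> space M. x \<in> U w \<longleftrightarrow> x \<in> S} \<in> events" for x
    proof (cases "x \<in> S")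
      case False
      have "{w \<in> space M. x \<notin> U w} = space M - {w \<in> space M. x \<in> U w}" by auto
      then show ?thesis using False U[of x] by auto
    qed (use U in simp)
    then have "{w \<in> space M. \<forall>x\<in>UNIV. x \<in> U w \<longleftrightarrow> x \<in> S} \<in> events"
      by (intro sets.sets_Collect_countable_All') auto
    then show ?thesis by (simp add: set_eq_iff)
  qed
  have count: "(\<Union>S\<in>{S. finite S \<and> R S}. {w \<in> space M. U w = S}) \<in> events" for R
  proof (rule sets.countable_UN'')
    show "countable {S :: 'b set. finite S \<and> R S}"
      using countable_Collect_finite by (rule countable_subset[rotated]) auto
  qed (use eq in auto)
  show ?thesis
  proof (cases "finite (UNIV :: 'b set) \<or> \<not> Q UNIV")
    case True
    then have "{w \<in> space M. Q (U w)} = (\<Union>S\<in>{S. finite S \<and> Q S}. {w \<in> space M. U w = S})"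
      using Q rev_finite_subset[of UNIV] by blast
    then show ?thesis using count[of Q] by simp
  next
    case False
    then have "{w \<in> space M. Q (U w)} = space M - (\<Union>S\<in>{S. finite S \<and> \<not> Q S}. {w \<in> space M. U w = S})"
      using Q by blast
    then show ?thesis using count[of "\<lambda>S. \<not> Q S"] by simp
  qed
qed

text \<open>The set \<open>A\<close> where the conditional probability exceeds \<open>c\<close> lies
  in \<open>F\<close>. By \<open>le\<close> the excess has integral at most zero over
  \<open>A\<close>, yet it is positive there, so \<open>A\<close> is null.\<close>

lemma real_cond_exp_indicator_le:
  assumes F: "subalgebra M F" and B: "B \<in> events"
    and le: "\<And>A. A \<in> sets F \<Longrightarrow> prob (B \<inter> A) \<le> c * prob A"
  shows "AE w in M. real_cond_exp M F (indicator B) w \<le> c"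
proof -
  interpret finite_measure_subalgebra M F by unfold_locales (rule F)
  let ?f = "real_cond_exp M F (indicator B)"
  have int_ind: "integrable M (indicator C :: 'a \<Rightarrow> real)" if "C \<in> events" for C
    using that by (intro integrable_real_indicator) (auto simp: less_top[symmetric])
  have int_f: "integrable M ?f" using int_ind[OF B] by (rule real_cond_exp_int)
  define A where "A = {w \<in> space M. c < ?f w}"
  have "A = {w \<in> space F. c < ?f w}" using F by (simp add: A_def subalgebra_def)
  then have AF: "A \<in> sets F" by simp
  then have AM: "A \<in> events" using F by (auto simp: subalgebra_def)
  have "(\<integral>w\<in>A. indicator B w \<partial>M) = (\<integral>w\<in>A. ?f w \<partial>M)"
    using int_ind[OF B] AF by (intro real_cond_exp_intA)
  moreover have "(\<integral>w\<in>A. indicator B w \<partial>M) = prob (B \<inter> A)"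
  proof -
    have "(\<lambda>w. indicator A w *\<^sub>R (indicator B w :: real)) = indicator (B \<inter> A)"
      by (auto simp: indicator_def)
    then show ?thesis using AM B by (simp add: set_lebesgue_integral_def)
  qed
  ultimately have fA: "(\<integral>w. indicator A w * ?f w \<partial>M) \<le> c * prob A"
    using le[OF AF] by (simp add: set_lebesgue_integral_def)
  let ?g = "\<lambda>w. indicator A w * ?f w - c * indicator A w"
  have int_A: "integrable M (\<lambda>w. indicator A w * ?f w)"
    using integrable_mult_indicator[OF AM int_f] by simp
  have int_c: "integrable M (\<lambda>w. c * indicator A w)" using int_ind[OF AM] by (rule integrable_mult_right)
  have int_g: "integrable M ?g" using int_A int_c by (rule Bochner_Integration.integrable_diff)
  have nonneg: "0 \<le> ?g w" for w by (auto simp: A_def indicator_def)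
  have "(\<integral>w. ?g w \<partial>M) = (\<integral>w. indicator A w * ?f w \<partial>M) - c * prob A"
    using int_A int_c AM by simp
  then have "(\<integral>w. ?g w \<partial>M) \<le> 0" using fA by simp
  moreover have "0 \<le> (\<integral>w. ?g w \<partial>M)" using nonneg by (intro Bochner_Integration.integral_nonneg)
  ultimately have "AE w in M. ?g w = 0"
    using integral_nonneg_eq_0_iff_AE[OF int_g] nonneg by simp
  then show ?thesis
    by (rule AE_mp) (auto intro!: AE_I2 simp: A_def indicator_def split: if_splits)
qed

end

lemma prob_geometric_tail:
  assumes "0 \<le> q" "q < 1"
  shows "measure_pmf.prob (geometric_pmf (1 - q)) {k..} = q ^ k"
proof -
  have "measure_pmf.prob (geometric_pmf (1 - q)) {..<k} = (\<Sum>j<k. q ^ j * (1 - q))"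
    using assms by (subst measure_measure_pmf_finite) auto
  also have "\<dots> = 1 - q ^ k"
    by (simp add: sum_distrib_right[symmetric] sum_gp_strict assms less_imp_neq)
  finally have "measure_pmf.prob (geometric_pmf (1 - q)) {..<k} = 1 - q ^ k" .
  moreover have "UNIV - {..<k} = {k..}" by auto
  ultimately show ?thesis
    using measure_pmf.prob_compl[of "{..<k}" "geometric_pmf (1 - q)"] by simp
qed

section \<open>Convergence of the box process\<close>

lemma zero_diagonal_box_chi:
  "zero_diagonal t c1 c2 c \<Longrightarrow> zero_diagonal t (box_chi N c1) (box_chi N c2) c"
  by (simp add: zero_diagonal_def box_chi_def)

text \<open>The properties of a typical sample path; the convergence statements in this locale are
  deterministic.\<close>

locale zero_diagonals =
  fixes t :: nat and c1 c2 :: "int \<Rightarrow> nat \<Rightarrow> bool" and eta v h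
  assumes cc: "consistent_classes c1 c2 eta v h"
    and left: "\<And>n. \<exists>c<n. zero_diagonal t c1 c2 c"
    and right: "\<And>n. \<exists>c>n. zero_diagonal t c1 c2 c"
begin

text \<open>Right of a diagonal starting at or after column \<open>- N\<close>, and up to column
  \<open>N\<close>, the truncated variables equal the original ones, so the uniqueness lemma
  applies.\<close>

lemma box_agrees:
  assumes c: "zero_diagonal t c1 c2 c" and N: "- int N \<le> c"
  shows "s \<le> t \<Longrightarrow> c + int s \<le> x \<Longrightarrow> x \<le> int N \<Longrightarrow> v x s = box_v N eta c1 c2 x s"
    and "s < t \<Longrightarrow> c + int s < x \<Longrightarrow> x \<le> int N + 1 \<Longrightarrow> h x s = box_h N eta c1 c2 x s"
  by (rule right_of_zero_diagonal_unique[OF cc box_consistent c zero_diagonal_box_chi[OF c], where b = "int N"];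
      use N in \<open>auto simp: box_chi_def\<close>)+

lemma eventually_box_v:
  assumes "s \<le> t"
  shows "\<forall>\<^sub>F N in sequentially. box_v N eta c1 c2 x s = v x s"
proof -
  obtain c where c: "c < x - int t" "zero_diagonal t c1 c2 c" using left by blast
  show ?thesis
    using eventually_ge_at_top[of "nat (\<bar>c\<bar> + \<bar>x\<bar>)"]
    by eventually_elim (use c assms in \<open>auto intro!: box_agrees(1)[OF c(2), symmetric]\<close>)
qed

lemma eventually_box_h:
  assumes "s < t"
  shows "\<forall>\<^sub>F N in sequentially. box_h N eta c1 c2 x s = h x s"
proof -
  obtain c where c: "c < x - int t" "zero_diagonal t c1 c2 c" using left by blast
  show ?thesis
    using eventually_ge_at_top[of "nat (\<bar>c\<bar> + \<bar>x\<bar>)"]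
    by eventually_elim (use c assms in \<open>auto intro!: box_agrees(2)[OF c(2), symmetric]\<close>)
qed

text \<open>Let the particles of classes in \<open>C\<close> start between \<open>a\<close> and
  \<open>b\<close>. Left of \<open>a\<close> neither process has any, as they never move left; from
  \<open>a\<close> to \<open>N\<close> the processes agree; right of \<open>N\<close> a diagonal
  beyond \<open>b\<close> keeps them out of both.\<close>

lemma eventually_box_v_uniform:
  assumes s: "s \<le> t" and fin: "finite {x. eta x \<in> C}"
  shows "\<forall>\<^sub>F N in sequentially. \<forall>x.
    v x s = box_v N eta c1 c2 x s \<or> v x s \<notin> C \<and> box_v N eta c1 c2 x s \<notin> C"
proof -
  obtain a where a: "\<And>x. eta x \<in> C \<Longrightarrow> a \<le> x"
    using bdd_below_finite[OF fin] unfolding bdd_below_def by blast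
  obtain b where b: "\<And>x. eta x \<in> C \<Longrightarrow> x \<le> b"
    using bdd_above_finite[OF fin] unfolding bdd_above_def by blast
  obtain cl where cl: "cl < a - int t" "zero_diagonal t c1 c2 cl" using left by blast
  obtain cr where cr: "cr > b" "zero_diagonal t c1 c2 cr" using right by blast
  show ?thesis
    using eventually_ge_at_top[of "nat (\<bar>cl\<bar> + \<bar>cr\<bar> + int t)"]
  proof eventually_elim
    case (elim N)
    show ?case
    proof
      fix x
      consider "x < a" | "a \<le> x" "x \<le> int N" | "int N < x" by linarith
      then show "v x s = box_v N eta c1 c2 x s \<or> v x s \<notin> C \<and> box_v N eta c1 c2 x s \<notin> C"
      proof cases
        case 1
        \<comment> \<open>This diagonal may depend on \<open>x\<close>, because the box process
          inherits it for every \<open>N\<close>.\<close>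
        obtain c where c: "c < x - int t" "zero_diagonal t c1 c2 c" using left by blast
        have "v x s \<notin> C" "box_v N eta c1 c2 x s \<notin> C"
          by (rule right_of_zero_diagonal_avoids[OF cc c(2), where b = a]
              right_of_zero_diagonal_avoids[OF box_consistent zero_diagonal_box_chi[OF c(2)], where b = a];
              use a c s 1 in force)+
        then show ?thesis by simp
      next
        case 2
        then have "v x s = box_v N eta c1 c2 x s"
          using cl elim s by (intro box_agrees(1)[OF cl(2)]) auto
        then show ?thesis by simp
      next
        case 3
        have "v x s \<notin> C" "box_v N eta c1 c2 x s \<notin> C"
          by (rule right_of_zero_diagonal_avoids[OF cc cr(2), where b = "x + 1"]
              right_of_zero_diagonal_avoids[OF box_consistent zero_diagonal_box_chi[OF cr(2)], where b = "x + 1"];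
              use b cr s 3 elim in force)+
        then show ?thesis by simp
      qed
    qed
  qed
qed

end

lemma thirds_right_of_second_cong:
  assumes "\<And>x. \<sigma> x = \<tau> x \<or> \<sigma> x \<notin> {2, 3} \<and> \<tau> x \<notin> {2, 3}"
  shows "thirds_right_of_second \<sigma> = thirds_right_of_second \<tau>"
proof -
  have "\<sigma> x = 2 \<longleftrightarrow> \<tau> x = 2" "\<sigma> x = 3 \<longleftrightarrow> \<tau> x = 3" for x using assms[of x] by auto
  then show ?thesis by (simp add: thirds_right_of_second_def)
qed

lemma ordered_position_cong:
  assumes "\<And>x. \<sigma> x \<in> {2, 3} \<longleftrightarrow> \<tau> x \<in> {2, 3}"
  shows "ordered_position \<sigma> = ordered_position \<tau>"
  using assms unfolding ordered_position_def by presburger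

text \<open>The front after \<open>t\<close> rows is the configuration at time \<open>t\<close>
  shifted by \<open>t\<close>.\<close>

lemma thirds_right_of_second_shift:
  "thirds_right_of_second (\<lambda>x. \<sigma> (x - d)) = thirds_right_of_second \<sigma>"
proof -
  have "{x. \<sigma> (x - d) = 3 \<and> (\<exists>y. \<sigma> (y - d) = 2 \<and> y < x)} =
      (\<lambda>x. x + d) ` {x. \<sigma> x = 3 \<and> (\<exists>y. \<sigma> y = 2 \<and> y < x)}"
  proof (intro equalityI subsetI)
    fix x assume "x \<in> {x. \<sigma> (x - d) = 3 \<and> (\<exists>y. \<sigma> (y - d) = 2 \<and> y < x)}"
    then show "x \<in> (\<lambda>x. x + d) ` {x. \<sigma> x = 3 \<and> (\<exists>y. \<sigma> y = 2 \<and> y < x)}"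
      by (intro image_eqI[of _ _ "x - d"]) auto
  qed (auto intro!: exI[of _ "_ + d"])
  then show ?thesis
    unfolding thirds_right_of_second_def by (simp add: card_image)
qed

context stochastic_six_vertex
begin

section \<open>Almost sure existence of zero diagonals\<close>

lemma prob_zero_site:
  assumes b: "0 \<le> b1" "b1 \<le> 1" "0 \<le> b2" "b2 \<le> 1"
  shows "prob (chi_event (\<lambda>c1 c2. \<not> c1 x s \<and> \<not> c2 x s)) = (1 - b1) * (1 - b2)"
proof -
  let ?X = "case_sum (\<lambda>(x, t). chi1 x t) (\<lambda>(x, t). chi2 x t)"
  let ?J = "{Inl (x, s), Inr (x, s)}"
  \<comment> \<open>\<open>chi_event_indep\<close> separates different vertices only, so for the two
    variables of one vertex \<open>indep_chi\<close> is used directly.\<close>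
  have "prob (\<Inter>i\<in>?J. ?X i -` {False} \<inter> space P) = (\<Prod>i\<in>?J. prob (?X i -` {False} \<inter> space P))"
    by (rule indep_varsD[OF indep_chi]) auto
  moreover have "(\<Inter>i\<in>?J. ?X i -` {False} \<inter> space P) = chi_event (\<lambda>c1 c2. \<not> c1 x s \<and> \<not> c2 x s)"
    by (auto simp: chi_event_def)
  moreover have "?X (Inl (x, s)) -` {False} \<inter> space P = chi_event (\<lambda>c1 c2. \<not> c1 x s)"
    "?X (Inr (x, s)) -` {False} \<inter> space P = chi_event (\<lambda>c1 c2. \<not> c2 x s)"
    by (auto simp: chi_event_def)
  moreover have "prob (chi_event (\<lambda>c1 c2. \<not> c1 x s)) = 1 - b1" "prob (chi_event (\<lambda>c1 c2. \<not> c2 x s)) = 1 - b2"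
    using prob_chi[OF b, of x s]
    by (subst prob_chi_event_complement[of "{(x, s)}"]; simp add: depends_on_def)+
  ultimately show ?thesis by simp
qed

definition diagonal :: "nat \<Rightarrow> int \<Rightarrow> (int \<times> nat) set" where
  "diagonal t c = (\<lambda>s. (c + int s, s)) ` {..<t}"

lemma depends_on_zero_diagonal: "depends_on (\<lambda>c1 c2. zero_diagonal t c1 c2 c) (diagonal t c)"
  by (rule depends_onI) (auto simp: zero_diagonal_def diagonal_def)

lemma finite_diagonal: "finite (diagonal t c)"
  by (simp add: diagonal_def)

lemma diagonal_disjoint: "c \<noteq> d \<Longrightarrow> diagonal t c \<inter> diagonal t d = {}"
  by (auto simp: diagonal_def)

lemma prob_zero_diagonal:
  assumes b: "0 \<le> b1" "b1 \<le> 1" "0 \<le> b2" "b2 \<le> 1"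
  shows "prob (chi_event (\<lambda>c1 c2. zero_diagonal t c1 c2 c)) = ((1 - b1) * (1 - b2)) ^ t"
proof (induction t)
  case 0
  then show ?case by (simp add: zero_diagonal_def chi_event_def prob_space)
next
  case (Suc t)
  let ?\<psi> = "\<lambda>c1 c2 :: int \<Rightarrow> nat \<Rightarrow> bool. \<not> c1 (c + int t) t \<and> \<not> c2 (c + int t) t"
  have "depends_on ?\<psi> {(c + int t, t)}" by (rule depends_onI) simp
  then have "prob (chi_event (\<lambda>c1 c2. zero_diagonal t c1 c2 c \<and> ?\<psi> c1 c2)) =
      prob (chi_event (\<lambda>c1 c2. zero_diagonal t c1 c2 c)) * prob (chi_event ?\<psi>)"
    by (intro chi_event_indep[OF finite_diagonal depends_on_zero_diagonal]) (auto simp: diagonal_def)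
  moreover have "zero_diagonal (Suc t) c1 c2 c \<longleftrightarrow> zero_diagonal t c1 c2 c \<and> ?\<psi> c1 c2" for c1 c2
    by (auto simp: zero_diagonal_def less_Suc_eq)
  ultimately show ?case using Suc prob_zero_site[OF b] by simp
qed

text \<open>Different diagonals share no vertex, so their failures are independent. The first
  \<open>m\<close> all fail with probability \<open>?r ^ m\<close>, where
  \<open>?r < 1\<close>.\<close>

lemma AE_zero_diagonal:
  assumes b: "0 \<le> b1" "b1 < 1" "0 \<le> b2" "b2 < 1" and f: "inj f"
  shows "AE w in P. \<exists>k. zero_diagonal t (\<lambda>x s. chi1 x s w) (\<lambda>x s. chi2 x s w) (f (k :: nat))"
proof -
  let ?zd = "\<lambda>k c1 c2. zero_diagonal t c1 c2 (f k)"
  let ?r = "1 - ((1 - b1) * (1 - b2)) ^ t"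
  let ?N = "\<lambda>m. chi_event (\<lambda>c1 c2. \<forall>k<m. \<not> ?zd k c1 c2)"
  let ?J = "\<lambda>m. \<Union>k<m. diagonal t (f k)"
  have dep: "depends_on (\<lambda>c1 c2. \<forall>k<m. \<not> ?zd k c1 c2) (?J m)" for m
  proof (rule depends_onI)
    fix c1 c2 d1 d2 :: "int \<Rightarrow> nat \<Rightarrow> bool"
    assume "\<And>x s. (x, s) \<in> ?J m \<Longrightarrow> c1 x s = d1 x s \<and> c2 x s = d2 x s"
    then have "?zd k c1 c2 = ?zd k d1 d2" if "k < m" for k
      using that by (intro depends_onD[OF depends_on_zero_diagonal]) auto
    then show "(\<forall>k<m. \<not> ?zd k c1 c2) = (\<forall>k<m. \<not> ?zd k d1 d2)" by simp
  qed
  have fin: "finite (?J m)" for m by (simp add: finite_diagonal)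
  have prob_N: "prob (?N m) = ?r ^ m" for m
  proof (induction m)
    case 0
    then show ?case by (simp add: chi_event_def prob_space)
  next
    case (Suc m)
    have disj: "?J m \<inter> diagonal t (f m) = {}"
    proof -
      have "diagonal t (f k) \<inter> diagonal t (f m) = {}" if "k < m" for k
        using that injD[OF f] by (intro diagonal_disjoint) auto
      then show ?thesis by blast
    qed
    have "prob (chi_event (\<lambda>c1 c2. (\<forall>k<m. \<not> ?zd k c1 c2) \<and> \<not> ?zd m c1 c2)) =
        prob (?N m) * prob (chi_event (\<lambda>c1 c2. \<not> ?zd m c1 c2))"
      by (rule chi_event_indep[OF fin dep finite_diagonal
            depends_on_comp[OF depends_on_zero_diagonal, of Not] disj])
    moreover have "(\<forall>k<Suc m. \<not> ?zd k c1 c2) \<longleftrightarrow> (\<forall>k<m. \<not> ?zd k c1 c2) \<and> \<not> ?zd m c1 c2" for c1 c2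
      by (auto simp: less_Suc_eq)
    moreover have "prob (chi_event (\<lambda>c1 c2. \<not> ?zd m c1 c2)) = ?r"
      using prob_chi_event_complement[OF finite_diagonal depends_on_zero_diagonal] prob_zero_diagonal b
      by simp
    ultimately show ?case using Suc by simp
  qed
  let ?E = "\<Inter>m. ?N m"
  have E: "?E \<in> events" using chi_event_measurable[OF fin dep] by blast
  have p: "0 < (1 - b1) * (1 - b2)" "(1 - b1) * (1 - b2) \<le> 1"
    using b by (auto intro!: mult_le_one)
  then have r: "0 \<le> ?r" "?r < 1"
    using power_le_one[of "(1 - b1) * (1 - b2)" t] by auto
  have "prob ?E \<le> ?r ^ m" for m
    unfolding prob_N[of m, symmetric]
    by (intro finite_measure_mono chi_event_measurable[OF fin dep]) auto
  then have "prob ?E \<le> 0"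
    using LIMSEQ_realpow_zero[OF r] by (intro LIMSEQ_le_const) auto
  then have "prob ?E = 0" by (simp add: measure_le_0_iff)
  then have null: "?E \<in> null_sets P" using E by (simp add: null_sets_def emeasure_eq_measure)
  show ?thesis
  proof (rule AE_I'[OF null])
    show "{w \<in> space P. \<not> (\<exists>k. zero_diagonal t (\<lambda>x s. chi1 x s w) (\<lambda>x s. chi2 x s w) (f k))} \<subseteq> ?E"
      by (auto simp: chi_event_def)
  qed
qed

lemma AE_zero_diagonals:
  assumes b: "0 \<le> b1" "b1 < 1" "0 \<le> b2" "b2 < 1"
  shows "AE w in P. zero_diagonals t (\<lambda>x s. chi1 x s w) (\<lambda>x s. chi2 x s w) eta0
    (\<lambda>x s. V x s w) (\<lambda>x s. H x s w)"
proof -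
  let ?zd = "\<lambda>w. zero_diagonal t (\<lambda>x s. chi1 x s w) (\<lambda>x s. chi2 x s w)"
  \<comment> \<open>Two injective sequences of starting columns, one running left from
    \<open>n - 1\<close> and one running right from \<open>n + 1\<close>.\<close>
  have "AE w in P. \<forall>n. (\<exists>k. ?zd w (n - 1 - int k)) \<and> (\<exists>k. ?zd w (n + 1 + int k))"
    unfolding AE_all_countable using b
    by (intro allI AE_conjI AE_zero_diagonal) (auto simp: inj_def)
  with consistent show ?thesis
  proof eventually_elim
    case (elim w)
    show ?case
    proof
      fix n
      obtain k l where "?zd w (n - 1 - int k)" "?zd w (n + 1 + int l)" using elim(2) by blast
      then show "\<exists>c<n. ?zd w c" "\<exists>c>n. ?zd w c"
        by (intro exI[of _ "n - 1 - int k"] exI[of _ "n + 1 + int l"]; simp)+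
    qed (rule elim(1))
  qed
qed

end

section \<open>Conditioning on the history\<close>

lemma box_v_from_hist:
  assumes "s \<le> t"
  shows "(hist (box_site N) eta c1 c2 (t * (2 * N + 1)) ! (s * (2 * N + 1))) (x - int s) =
    merge_class (box_v N eta c1 c2 x s)"
proof -
  have "s * (2 * N + 1) \<le> t * (2 * N + 1)" using assms by (rule mult_le_mono1)
  then show ?thesis unfolding box_v_def by (simp only: nth_hist comp_apply)
qed

lemma box_h_from_hist:
  assumes "s < t"
  shows "(hist (box_site N) eta c1 c2 (t * (2 * N + 1)) ! (s * (2 * N + 1) + box_column N x)) (x - int s - 1) =
    merge_class (box_h N eta c1 c2 x s)"
proof -
  \<comment> \<open>A horizontal edge of row \<open>s\<close> is stored before or at the end of that
    row, which is recorded because \<open>s < t\<close>.\<close>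
  have "s * (2 * N + 1) + box_column N x \<le> Suc s * (2 * N + 1)" by (auto simp: box_column_def)
  also have "\<dots> \<le> t * (2 * N + 1)" using assms by (intro mult_le_mono1) simp
  finally show ?thesis unfolding box_h_def by (simp only: nth_hist comp_apply)
qed

lemma merge_class_eq_1_iff [simp]: "merge_class c = 1 \<longleftrightarrow> c = 1"
  by (auto simp: merge_class_def)

lemma ordered_position_merge_class:
  "ordered_position (\<lambda>x. merge_class (\<sigma> x)) = ordered_position \<sigma>"
  by (rule ordered_position_cong) (auto simp: merge_class_def)

context stochastic_six_vertex
begin

text \<open>The box counterpart of the conditioning sigma-algebra: all conditions on the merged
  configurations at every step through the first \<open>t\<close> rows.\<close>

definition box_history_algebra :: "nat \<Rightarrow> nat \<Rightarrow> 'w set set" where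
  "box_history_algebra t N =
    range (\<lambda>S. chi_event (\<lambda>c1 c2. hist (box_site N) eta0 c1 c2 (t * (2 * N + 1)) \<in> S))"

lemma box_history_algebra_subset: "box_history_algebra t N \<subseteq> events"
proof -
  have "chi_event (\<lambda>c1 c2. hist (box_site N) eta0 c1 c2 n \<in> S) \<in> events" for n S
    by (rule chi_event_measurable[OF _ depends_on_comp[OF depends_on_hist, where g = "\<lambda>h. h \<in> S"]]) simp
  then show ?thesis by (auto simp: box_history_algebra_def)
qed

lemma algebra_box_history: "algebra (space P) (box_history_algebra t N)"
proof -
  let ?E = "\<lambda>S. chi_event (\<lambda>c1 c2. hist (box_site N) eta0 c1 c2 (t * (2 * N + 1)) \<in> S)"
  have compl: "space P - ?E S = ?E (- S)" and un: "?E S \<union> ?E T = ?E (S \<union> T)"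
    and empty: "{} = ?E {}" and sub: "?E S \<subseteq> space P" for S T
    by (auto simp: chi_event_def)
  show ?thesis
    unfolding algebra_iff_Un box_history_algebra_def
  proof (intro conjI ballI)
    show "range ?E \<subseteq> Pow (space P)" using sub by blast
    show "{} \<in> range ?E" unfolding empty by (rule rangeI)
    show "space P - A \<in> range ?E" if "A \<in> range ?E" for A
      using that by (elim rangeE) (simp only: compl, rule rangeI[of ?E])
    show "A \<union> B \<in> range ?E" if "A \<in> range ?E" "B \<in> range ?E" for A B
      using that by (elim rangeE) (simp only: un, rule rangeI[of ?E])
  qed
qed

section \<open>Measurability and the generators of the history\<close>

lemma class_event: "{w \<in> space P. V x s w = c} \<in> events" "{w \<in> space P. H x s w = c} \<in> events"
  using measurable_V measurable_H by measurable

lemma ordered_position_event: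
  "{w \<in> space P. ordered_position (\<lambda>x. V x s w) k = z} \<in> events"
proof -
  have "{w \<in> space P. rev (sorted_list_of_set {x. V x s w \<in> {2, 3}}) ! k = z} \<in> events"
  proof (rule random_set_predicate_measurable)
    have "{w \<in> space P. x \<in> {x. V x s w \<in> {2, 3}}} = {w \<in> space P. V x s w = 2} \<union> {w \<in> space P. V x s w = 3}" for x
      by auto
    then show "{w \<in> space P. x \<in> {x. V x s w \<in> {2, 3}}} \<in> events" for x
      using class_event by simp
  qed simp
  then show ?thesis by (simp add: ordered_position_def)
qed

lemma thirds_right_event:
  "{w \<in> space P. k \<le> thirds_right_of_second (\<lambda>x. V x s w)} \<in> events"
  unfolding thirds_right_of_second_def
proof (rule random_set_predicate_measurable)
  fix x
  have "{w \<in> space P. x \<in> {x. V x s w = 3 \<and> (\<exists>y. V y s w = 2 \<and> y < x)}} =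
      {w \<in> space P. V x s w = 3} \<inter> (\<Union>y\<in>{..<x}. {w \<in> space P. V y s w = 2})"
    by auto
  also have "\<dots> \<in> events" using class_event by (intro sets.Int sets.countable_UN') auto
  finally show "{w \<in> space P. x \<in> {x. V x s w = 3 \<and> (\<exists>y. V y s w = 2 \<and> y < x)}} \<in> events" .
qed simp

definition history_generators :: "nat \<Rightarrow> nat \<Rightarrow> 'w set set" where
  "history_generators M t =
    {{w \<in> space P. ordered_position (\<lambda>x. V x s w) k = z} | s k z. s \<le> t \<and> k \<le> M} \<union>
    {{w \<in> space P. V x s w = 1} | x s. s \<le> t} \<union>
    {{w \<in> space P. H x s w = 1} | x s. s < t}"

lemma history_generators_subset: "history_generators M t \<subseteq> events"
  unfolding history_generators_def using class_event ordered_position_event by blast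

lemma sets_history:
  "sets (history P V H (\<lambda>s k w. ordered_position (\<lambda>x. V x s w) k) M t) =
    sigma_sets (space P) (history_generators M t)"
  unfolding history_def history_generators_def[symmetric]
  using history_generators_subset sets.space_closed by (intro sets_measure_of) blast

lemma subalgebra_history:
  "subalgebra P (history P V H (\<lambda>s k w. ordered_position (\<lambda>x. V x s w) k) M t)"
  unfolding subalgebra_def sets_history
proof
  show "space (history P V H (\<lambda>s k w. ordered_position (\<lambda>x. V x s w) k) M t) = space P"
    by (simp add: history_def space_measure_of_conv)
  show "sigma_sets (space P) (history_generators M t) \<subseteq> events"
    by (rule sets.sigma_sets_subset[OF history_generators_subset])
qed

text \<open>Merging keeps class 1 and the set of positions of classes 2 and 3, so every generator
  can be evaluated on the merged box history, almost surely correctly for all large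
  \<open>N\<close>. Closure of the approximable sets does the rest.\<close>

lemma history_approximable:
  assumes b: "0 \<le> b1" "b1 < 1" "0 \<le> b2" "b2 < 1" and fin: "finite {x. eta0 x \<in> {2, 3}}"
    and A: "A \<in> sets (history P V H (\<lambda>s k w. ordered_position (\<lambda>x. V x s w) k) M t)"
  shows "approximable (box_history_algebra t) A"
proof -
  let ?C1 = "\<lambda>w x s. chi1 x s w" and ?C2 = "\<lambda>w x s. chi2 x s w"
  let ?h = "\<lambda>N w. hist (box_site N) eta0 (?C1 w) (?C2 w) (t * (2 * N + 1))"
  note zd = AE_zero_diagonals[OF b, of t]
  have approx: "approximable (box_history_algebra t) {w \<in> space P. \<phi> w}"
    if "{w \<in> space P. \<phi> w} \<in> events"
      and "AE w in P. \<forall>\<^sub>F N in sequentially. \<phi> w \<longleftrightarrow> ?h N w \<in> S N" for \<phi> S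
  proof (rule approximableI[OF that(1)])
    let ?B = "\<lambda>N. chi_event (\<lambda>c1 c2. hist (box_site N) eta0 c1 c2 (t * (2 * N + 1)) \<in> S N)"
    show "?B N \<in> box_history_algebra t N" for N by (auto simp: box_history_algebra_def)
    show "box_history_algebra t N \<subseteq> events" for N by (rule box_history_algebra_subset)
    show "AE w in P. \<forall>\<^sub>F N in sequentially. w \<in> {w \<in> space P. \<phi> w} \<longleftrightarrow> w \<in> ?B N"
      using that(2) by (rule AE_mp) (auto intro!: AE_I2 elim!: eventually_mono simp: chi_event_def)
  qed
  have "approximable (box_history_algebra t) {w \<in> space P. V x s w = 1}" if s: "s \<le> t" for x s
  proof (rule approx[of _ "\<lambda>N. {l. (l ! (s * (2 * N + 1))) (x - int s) = 1}"])
    show "AE w in P. \<forall>\<^sub>F N in sequentially.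
        V x s w = 1 \<longleftrightarrow> ?h N w \<in> {l. (l ! (s * (2 * N + 1))) (x - int s) = 1}"
      using zd
    proof eventually_elim
      case (elim w)
      show ?case
        using zero_diagonals.eventually_box_v[OF elim s, of x]
        by eventually_elim (simp only: mem_Collect_eq box_v_from_hist[OF s] merge_class_eq_1_iff)
    qed
  qed (rule class_event)
  moreover have "approximable (box_history_algebra t) {w \<in> space P. H x s w = 1}" if s: "s < t" for x s
  proof (rule approx[of _ "\<lambda>N. {l. (l ! (s * (2 * N + 1) + box_column N x)) (x - int s - 1) = 1}"])
    show "AE w in P. \<forall>\<^sub>F N in sequentially.
        H x s w = 1 \<longleftrightarrow> ?h N w \<in> {l. (l ! (s * (2 * N + 1) + box_column N x)) (x - int s - 1) = 1}"
      using zd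
    proof eventually_elim
      case (elim w)
      show ?case
        using zero_diagonals.eventually_box_h[OF elim s, of x]
        by eventually_elim (simp only: mem_Collect_eq box_h_from_hist[OF s] merge_class_eq_1_iff)
    qed
  qed (rule class_event)
  moreover have "approximable (box_history_algebra t)
      {w \<in> space P. ordered_position (\<lambda>x. V x s w) k = z}" if s: "s \<le> t" for s k z
  proof (rule approx[of _ "\<lambda>N. {l. ordered_position (\<lambda>x. (l ! (s * (2 * N + 1))) (x - int s)) k = z}"])
    show "AE w in P. \<forall>\<^sub>F N in sequentially. ordered_position (\<lambda>x. V x s w) k = z \<longleftrightarrow>
        ?h N w \<in> {l. ordered_position (\<lambda>x. (l ! (s * (2 * N + 1))) (x - int s)) k = z}"
      using zd
    proof eventually_elim
      case (elim w)
      show ?case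
        \<comment> \<open>An ordered position involves all columns at once, so convergence column by
          column is not enough.\<close>
        using zero_diagonals.eventually_box_v_uniform[OF elim s fin]
      proof eventually_elim
        case (elim N)
        then have "ordered_position (\<lambda>x. V x s w) =
            ordered_position (\<lambda>x. box_v N eta0 (?C1 w) (?C2 w) x s)"
          by (intro ordered_position_cong) metis
        then show ?case
          by (simp only: mem_Collect_eq box_v_from_hist[OF s] ordered_position_merge_class)
      qed
    qed
  qed (rule ordered_position_event)
  ultimately have "approximable (box_history_algebra t) G" if "G \<in> history_generators M t" for G
    using that unfolding history_generators_def by blast
  then show ?thesis
    by (intro approximable_sigma_sets[OF algebra_box_history box_history_algebra_subset _
          A[unfolded sets_history]])
qed

text \<open>The rank event is replaced by its box version and \<open>A\<close> by an event
  \<open>B\<close> of the merged box history, where the bound is known. Each replacement costs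
  \<open>\<epsilon> / 3\<close>, and so does returning from \<open>prob B\<close> to
  \<open>prob A\<close>.\<close>

lemma prob_thirds_right_and_history:
  assumes b: "0 < b1" "b1 < b2" "b2 < 1" and q: "q = b1 / b2" and adm: "admissible eta0"
    and init: "\<And>x y. eta0 x = 3 \<Longrightarrow> eta0 y = 2 \<Longrightarrow> x < y"
    and A: "A \<in> sets (history P V H (\<lambda>s k w. ordered_position (\<lambda>x. V x s w) k) M t)"
  shows "prob ({w \<in> space P. k \<le> thirds_right_of_second (\<lambda>x. V x t w)} \<inter> A) \<le> q ^ k * prob A"
proof (rule field_le_epsilon)
  fix \<epsilon> :: real assume \<epsilon>: "\<epsilon> > 0"
  let ?L = "{w \<in> space P. k \<le> thirds_right_of_second (\<lambda>x. V x t w)}"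
  let ?n = "\<lambda>N. t * (2 * N + 1)"
  let ?K = "\<lambda>N. chi_event (\<lambda>c1 c2. k \<le> thirds_right_of_second (box_front N eta0 c1 c2 (?n N)))"
  have b': "0 \<le> b1" "b1 < 1" "0 \<le> b2" "b2 < 1" using b by auto
  have fin: "finite {x. eta0 x \<in> {2, 3}}"
    using finite_merged[OF adm] by simp
  have K: "?K N \<in> events" for N
    by (rule chi_event_measurable[OF _ depends_on_comp[OF depends_on_front,
            where g = "\<lambda>\<sigma>. k \<le> thirds_right_of_second \<sigma>"]]) simp
  have "AE w in P. \<forall>\<^sub>F N in sequentially. w \<in> ?L \<longleftrightarrow> w \<in> ?K N"
    using AE_space AE_zero_diagonals[OF b', of t]
  proof eventually_elim
    case (elim w)
    let ?C1 = "\<lambda>x s. chi1 x s w" and ?C2 = "\<lambda>x s. chi2 x s w"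
    show ?case
      using zero_diagonals.eventually_box_v_uniform[OF elim(2) order_refl fin]
    proof eventually_elim
      case (elim N)
      then have "thirds_right_of_second (\<lambda>x. V x t w) =
          thirds_right_of_second (\<lambda>x. box_v N eta0 ?C1 ?C2 x t)"
        by (intro thirds_right_of_second_cong) blast
      also have "\<dots> = thirds_right_of_second (box_front N eta0 ?C1 ?C2 (?n N))"
        unfolding box_v_def by (rule thirds_right_of_second_shift)
      finally show ?case using \<open>w \<in> space P\<close> by (simp add: chi_event_def)
    qed
  qed
  then have "(\<lambda>N. prob (sym_diff ?L (?K N))) \<longlonglongrightarrow> 0"
    by (intro prob_sym_diff_tendsto_0 thirds_right_event K)
  then have "\<forall>\<^sub>F N in sequentially. prob (sym_diff ?L (?K N)) < \<epsilon> / 3"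
    using \<epsilon> by (intro order_tendstoD) auto
  moreover have "\<forall>\<^sub>F N in sequentially. \<exists>B\<in>box_history_algebra t N. prob (sym_diff A B) < \<epsilon> / 3"
  proof -
    have "\<epsilon> / 3 > 0" using \<epsilon> by simp
    then show ?thesis
      using history_approximable[OF b' fin A] unfolding approximable_def by blast
  qed
  ultimately have "\<forall>\<^sub>F N in sequentially. prob (sym_diff ?L (?K N)) < \<epsilon> / 3 \<and>
      (\<exists>B\<in>box_history_algebra t N. prob (sym_diff A B) < \<epsilon> / 3)"
    by (rule eventually_conj)
  then obtain N B where N: "prob (sym_diff ?L (?K N)) < \<epsilon> / 3"
    and B: "B \<in> box_history_algebra t N" "prob (sym_diff A B) < \<epsilon> / 3"
    unfolding eventually_sequentially by blast
  obtain S where S: "B = chi_event (\<lambda>c1 c2. hist (box_site N) eta0 c1 c2 (?n N) \<in> S)"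
    using B(1) by (auto simp: box_history_algebra_def)
  have ev: "?L \<in> events" "A \<in> events" "B \<in> events" "?K N \<in> events"
    using thirds_right_event subalgebra_history[of M t] A B(1) box_history_algebra_subset[of t N] K
    unfolding subalgebra_def by blast+
  have q01: "0 \<le> q" "q \<le> 1" using b q by auto
  have "?K N \<inter> B = chi_event (\<lambda>c1 c2. k \<le> thirds_right_of_second (box_front N eta0 c1 c2 (?n N)) \<and>
      hist (box_site N) eta0 c1 c2 (?n N) \<in> S)"
    unfolding S by (auto simp: chi_event_def)
  then have KB: "prob (?K N \<inter> B) \<le> q ^ k * prob B"
    using prob_thirds_right_and_hist[OF b q inj_box_site adm init] S by simp
  have "prob B \<le> prob (A \<union> sym_diff A B)"
    using ev by (intro finite_measure_mono) auto
  also have "\<dots> \<le> prob A + prob (sym_diff A B)"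
    using ev by (intro measure_Un_le) auto
  finally have "q ^ k * prob B \<le> q ^ k * (prob A + \<epsilon> / 3)"
    using B(2) q01 by (intro mult_left_mono) auto
  also have "\<dots> \<le> q ^ k * prob A + \<epsilon> / 3"
    using mult_right_mono[OF power_le_one[OF q01, of k], of "\<epsilon> / 3"] \<epsilon> by (simp add: distrib_left)
  finally have qB: "q ^ k * prob B \<le> q ^ k * prob A + \<epsilon> / 3" .
  have "prob (?L \<inter> A) \<le> prob ((?K N \<inter> B) \<union> (sym_diff ?L (?K N) \<union> sym_diff A B))"
    using ev by (intro finite_measure_mono) auto
  also have "\<dots> \<le> prob (?K N \<inter> B) + prob (sym_diff ?L (?K N) \<union> sym_diff A B)"
    using ev by (intro measure_Un_le) auto
  also have "\<dots> \<le> prob (?K N \<inter> B) + (prob (sym_diff ?L (?K N)) + prob (sym_diff A B))"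
    using ev by (intro add_left_mono measure_Un_le) auto
  finally show "prob (?L \<inter> A) \<le> q ^ k * prob A + \<epsilon>"
    using KB qB N B(2) by linarith
qed

end

theorem theorem1p6:
  fixes P :: "'w measure"
    and b1 b2 q :: real
    and eta0 :: "int \<Rightarrow> ereal"
    and chi1 chi2 :: "int \<Rightarrow> nat \<Rightarrow> 'w \<Rightarrow> bool"
    and V H :: "int \<Rightarrow> nat \<Rightarrow> 'w \<Rightarrow> ereal"
    and Z :: "nat \<Rightarrow> nat \<Rightarrow> 'w \<Rightarrow> int"
    and L :: "nat \<Rightarrow> 'w \<Rightarrow> nat"
    and M t :: nat
  assumes "0 < b1" and "b1 < b2" and "b2 < 1" and "q = b1 / b2"
    and "stochastic_six_vertex P b1 b2 eta0 chi1 chi2 V H"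
    and "\<And>x. eta0 x \<in> {1, 2, 3, \<infinity>}"
    and "\<exists>!x. eta0 x = 2"
    and "finite {x. eta0 x = 3}" and "card {x. eta0 x = 3} = M"
    and "\<And>x y. eta0 x = 3 \<Longrightarrow> eta0 y = 2 \<Longrightarrow> x < y"
  defines "Z \<equiv> \<lambda>s k w. ordered_position (\<lambda>x. V x s w) k"
    and "L \<equiv> \<lambda>s w. thirds_right_of_second (\<lambda>x. V x s w)"
  shows "cond_law_dominated_by P (history P V H Z M t) (L t) (geometric_pmf (1 - q))"
proof -
  interpret stochastic_six_vertex P b1 b2 eta0 chi1 chi2 V H by fact
  have adm: "admissible eta0"
    unfolding admissible_def using assms(6,7,8) by blast
  have tail: "measure_pmf.prob (geometric_pmf (1 - q)) {k..} = q ^ k" for k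
    using assms(1-4) by (intro prob_geometric_tail) auto
  \<comment> \<open>The bound on all events of the history gives the conditional bound through
    \<open>real_cond_exp_indicator_le\<close> with \<open>c = q ^ k\<close>. As there are countably
    many \<open>k\<close>, they share one null set.\<close>
  show ?thesis
    unfolding cond_law_dominated_by_def cond_prob_of_def AE_all_countable tail Z_def L_def
    by (intro allI real_cond_exp_indicator_le subalgebra_history thirds_right_event
        prob_thirds_right_and_history[OF assms(1-4) adm assms(10)])
qed

end
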